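(* Let $q$ be a parameter (an indeterminate over $\mathbb{C}$), let $F(q,x,w_0,\dots,w_n)\in\mathbb{C}[q,x,w_0,\dots,w_n]$, and let $\varphi(x)=y(x)=\sum_{h\geq 0}y_hx^h\in\mathbb{C}(q)[[x]]$ be a formal solution of $$F(q,x,y(x),y(qx),\dots,y(q^nx))=0.$$ Suppose that $$\frac{\partial F}{\partial w_n}(q,x,y(x),\dots,y(q^nx))\neq 0.$$ Let $\mathcal{F}_\varphi$ be the linearized $q$-difference operator of $F$ along $\varphi$. If $r\in\,]0,+\infty]$ (respectively $r'\in[-\infty,0[$) is the smallest positive slope (respectively the largest negative slope) of the Newton polygon $N_q(\mathcal{F}_\varphi)$, then $$\limsup_{h\to\infty}\frac{1}{h}\left(\deg_q y_h-s\frac{h(h-1)}{2}\right)<+\infty,\quad\text{with } s=\frac1r,$$ and $$\limsup_{h\to\infty}\frac{1}{h}\left(\operatorname{ord}_q y_h-s'\frac{h(h-1)}{2}\right)>-\infty,\quad\text{with } s'=-\frac1{r'},$$ where $1/(\pm\infty)=0$.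
   Context: For $y(x)=\sum_h y_hx^h\in\mathbb{C}(q)[[x]]$, put $y(q^ix)=\sum_h q^{ih}y_hx^h$ and let $\sigma_q$ be the operator $\sigma_q y(x)=y(qx)$ on $\mathbb{C}(q)[[x]]$. For a nonzero polynomial $f\in\mathbb{C}[q]$, $\deg_q f$ is its degree in $q$ and $\operatorname{ord}_q f$ is its order of vanishing at $q=0$; both extend to nonzero elements of $\mathbb{C}(q)$ by $\deg_q(f/g)=\deg_q f-\deg_q g$ and $\operatorname{ord}_q(f/g)=\operatorname{ord}_q f-\operatorname{ord}_q g$, with $\deg_q 0=-\infty$ and $\operatorname{ord}_q 0=+\infty$. Linearized operator: $\mathcal{F}_\varphi=\sum_{i=0}^n\frac{\partial F}{\partial w_i}(q,x,y(x),y(qx),\dots,y(q^nx))\,\sigma_q^i$. Newton polygon: for a linear $q$-difference operator $\mathcal{L}=\sum_{i=0}^n a_i(x)\sigma_q^i$ with $a_i(x)\in\mathbb{C}(q)[[x]]$ not all zero, $N_q(\mathcal{L})$ is the convex hull in $\mathbb{R}^2$ of $\bigcup_{i=0}^n\{(i,h): h\ge \operatorname{ord}_{x=0}a_i(x)\}$ (indices with $a_i=0$ contribute nothing). It has finitely many finite sides, with rational slopes, and two infinite vertical sides. By convention the right vertical side has slope $+\infty$ and the left vertical side has slope $-\infty$; thus the smallest positive slope is $+\infty$ if there is no finite side of positive slope, and the largest negative slope is $-\infty$ if there is no finite side of negative slope.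
   Formalization: The second claim is proved with s' = 1/r' instead of s' = -1/r'; as printed it is false: y(qx) = 1 + x y(x) has r' = -1 and y_h = q^{-h(h+1)/2}, so with s' = 1 the limsup is -∞. *)

theory Defs
  imports
    "HOL-Analysis.Analysis"
    "HOL-Computational_Algebra.Computational_Algebra"
    "HOL-Computational_Algebra.Field_as_Ring"
    "HOL-Library.Poly_Mapping"
begin

type_synonym ratfun = "complex poly fract"  \<comment> \<open>the field \<open>C(q)\<close>\<close>

definition qvar :: ratfun where
  "qvar = Fract [:0, 1:] 1"

definition deg_q :: "ratfun \<Rightarrow> ereal" where
  "deg_q a = (if a = 0 then -\<infinity> else
     (case quot_of_fract a of (f, g) \<Rightarrow> ereal (real (degree f) - real (degree g))))"

definition ord_q :: "ratfun \<Rightarrow> ereal" where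
  "ord_q a = (if a = 0 then \<infinity> else
     (case quot_of_fract a of (f, g) \<Rightarrow> ereal (real (order 0 f) - real (order 0 g))))"

text \<open>The two definitions use the reduced fraction, but every representation gives the same value.\<close>

lemma quot_of_fract_cross:
  fixes f g :: "complex poly"
  assumes "f \<noteq> 0" "g \<noteq> 0" "quot_of_fract (Fract f g) = (u, v)"
  shows "u \<noteq> 0" "v \<noteq> 0" "f * v = u * g"
proof -
  have v: "v \<noteq> 0"
    using snd_quot_of_fract_nonzero[of "Fract f g"] assms(3) by simp
  have "Fract u v = Fract f g"
    using Fract_quot_of_fract[of "Fract f g"] assms(3) by simp
  then show *: "f * v = u * g"
    using v assms(2) by (simp add: eq_fract)
  show "v \<noteq> 0" by fact
  show "u \<noteq> 0" using * v assms(1) by auto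
qed

lemma deg_q_Fract:
  assumes "f \<noteq> 0" "g \<noteq> 0"
  shows "deg_q (Fract f g) = ereal (real (degree f) - real (degree g))"
proof -
  obtain u v where uv: "quot_of_fract (Fract f g) = (u, v)" by force
  note c = quot_of_fract_cross[OF assms uv]
  have "degree f + degree v = degree u + degree g"
    using assms c by (metis degree_mult_eq)
  moreover have "Fract f g \<noteq> 0"
    using assms by (simp add: Zero_fract_def eq_fract)
  ultimately show ?thesis by (simp add: deg_q_def uv)
qed

lemma ord_q_Fract:
  assumes "f \<noteq> 0" "g \<noteq> 0"
  shows "ord_q (Fract f g) = ereal (real (order 0 f) - real (order 0 g))"
proof -
  obtain u v where uv: "quot_of_fract (Fract f g) = (u, v)" by force
  note c = quot_of_fract_cross[OF assms uv]
  have "order 0 f + order 0 v = order 0 u + order 0 g"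
    using assms c by (metis order_mult mult_eq_0_iff)
  moreover have "Fract f g \<noteq> 0"
    using assms by (simp add: Zero_fract_def eq_fract)
  ultimately show ?thesis by (simp add: ord_q_def uv)
qed

text \<open>
  The polynomial \<open>F(q, x, w\<^sub>0, \<dots>, w\<^sub>n)\<close> is a finitely supported map from monomials
  (exponent vectors over the variables below) to complex coefficients.
\<close>

datatype var = Var_q | Var_x | Var_w nat

type_synonym mpoly = "(var \<Rightarrow>\<^sub>0 nat) \<Rightarrow>\<^sub>0 complex"

definition vars :: "mpoly \<Rightarrow> var set" where
  "vars F = (\<Union>m\<in>Poly_Mapping.keys F. Poly_Mapping.keys m)"

definition partial_deriv :: "var \<Rightarrow> mpoly \<Rightarrow> mpoly" where
  "partial_deriv v F = (\<Sum>m\<in>Poly_Mapping.keys F.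
     Poly_Mapping.single (m - Poly_Mapping.single v 1)
       (of_nat (Poly_Mapping.lookup m v) * Poly_Mapping.lookup F m))"

definition dilate :: "nat \<Rightarrow> ratfun fps \<Rightarrow> ratfun fps" where  \<comment> \<open>\<open>y(q\<^sup>i x)\<close>\<close>
  "dilate i y = Abs_fps (\<lambda>h. qvar ^ (i * h) * fps_nth y h)"

primrec var_value :: "ratfun fps \<Rightarrow> var \<Rightarrow> ratfun fps" where
  "var_value y Var_q = fps_const qvar"
| "var_value y Var_x = fps_X"
| "var_value y (Var_w i) = dilate i y"

definition eval_along :: "mpoly \<Rightarrow> ratfun fps \<Rightarrow> ratfun fps" where
    \<comment> \<open>\<open>F(q, x, y(x), y(qx), \<dots>, y(q\<^sup>n x))\<close>\<close>
  "eval_along F y = (\<Sum>m\<in>Poly_Mapping.keys F.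
     fps_const (Fract [:Poly_Mapping.lookup F m:] 1) *
     (\<Prod>v\<in>Poly_Mapping.keys m. var_value y v ^ Poly_Mapping.lookup m v))"

text \<open>
  A linear \<open>q\<close>-difference operator \<open>\<Sum>i\<le>n. a i \<cdot> \<sigma>\<^sub>q\<^sup>i\<close>
  is represented by \<open>n\<close> and its coefficient sequence \<open>a\<close>, of which only
  the entries with index at most \<open>n\<close> matter.
\<close>

definition linearized :: "mpoly \<Rightarrow> ratfun fps \<Rightarrow> nat \<Rightarrow> ratfun fps" where
  "linearized F y i = eval_along (partial_deriv (Var_w i) F) y"

definition newton_polygon :: "nat \<Rightarrow> (nat \<Rightarrow> ratfun fps) \<Rightarrow> (real \<times> real) set" where
  "newton_polygon n a = convex hull
     (\<Union>i\<in>{i. i \<le> n \<and> a i \<noteq> 0}. {(real i, h) | h. h \<ge> real (subdegree (a i))})"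

text \<open>
  The finite sides are the bounded edges, none of which is vertical. The two infinite values
  are the slopes of the right and the left vertical side; both are present by convention also
  when these two sides coincide, i.e. when only one coefficient is nonzero.
\<close>

definition slopes :: "(real \<times> real) set \<Rightarrow> ereal set" where
  "slopes N = {\<infinity>, -\<infinity>} \<union>
     {ereal ((snd b - snd a) / (fst b - fst a)) | a b.
        \<exists>e. e edge_of N \<and> bounded e \<and> a \<in> e \<and> b \<in> e \<and> fst a < fst b}"

definition smallest_positive_slope :: "(real \<times> real) set \<Rightarrow> ereal \<Rightarrow> bool" where
  "smallest_positive_slope N r \<longleftrightarrow>
     r \<in> slopes N \<and> 0 < r \<and> (\<forall>t\<in>slopes N. 0 < t \<longrightarrow> r \<le> t)"

definition largest_negative_slope :: "(real \<times> real) set \<Rightarrow> ereal \<Rightarrow> bool" where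
  "largest_negative_slope N r \<longleftrightarrow>
     r \<in> slopes N \<and> r < 0 \<and> (\<forall>t\<in>slopes N. t < 0 \<longrightarrow> t \<le> r)"

text \<open>
  Sign convention: with \<open>s' = 1 / r'\<close>, which is at most \<open>0\<close>, a negative slope \<open>r'\<close> corresponds to
  \<open>q\<close>-orders of size \<open>s' h (h - 1) / 2\<close>. For example \<open>y(qx) = 1 + x y(x)\<close> has linearized operator
  \<open>\<sigma>\<^sub>q - x\<close> with the single finite slope \<open>-1\<close>, and its solution has \<open>y\<^sub>h = q\<^bsup>-h(h+1)/2\<^esup>\<close>.
  Replacing \<open>1 / r'\<close> by \<open>-1 / r'\<close> would turn the lower bound on the orders into a false claim.
\<close>

end

theory Submission
  imports Defs
begin

text \<open>
  Write \<open>\<delta>\<close> for \<open>deg\<^sub>q\<close> or \<open>-ord\<^sub>q\<close>. Expanding \<open>F\<close> at the truncation \<open>Y\<close> of \<open>y\<close> to the terms below \<open>x\<^sup>h\<close> and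
  comparing coefficients of \<open>x\<^bsup>h+l\<^esup>\<close>, where \<open>l\<close> is the height of the bottom of the polygon, gives
  \<open>P(q\<^sup>h) y\<^sub>h = - [x\<^bsup>h+l\<^esup>] F(Y)\<close> with a polynomial \<open>P\<close> read off from the horizontal side; its extremal
  exponent \<open>j\<close> is the end of that side. Splitting \<open>Y\<close> further into a fixed polynomial \<open>p\<close> of large degree \<open>M\<close>
  and a rest divisible by \<open>x\<^bsup>M+1\<^esup>\<close>, the linear terms of the right-hand side are controlled by the
  slope, and the higher terms gain so much from the divisibility that they do not matter. By
  induction \<open>\<delta>(y\<^sub>h) \<le> s (h - M)\<^sup>2 / 2 + C (h - M)\<close>.
\<close>

text \<open>The induction is not circular because of the order of the constants: those that bound
  the Taylor remainder depend on p, but neither on the index H reached nor on the linear constant C,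
  so C can be chosen last. The bound is a superadditive function of h - M, so a product of two tails
  divisible by x^M is bounded by its value at an argument smaller by M - l; this saves about s (M -
  l) h and pays for dilates that bring more growth than the one at j. If s = 0 nothing is saved, and
  no dilate stronger than the one at j may occur at all, not even in a nonlinear term. For the
  degree this is automatic, as the nonzero coefficient at n forces j = n. For the order it is an
  obstacle: the linearized operator has no coefficients below j, yet F may involve the variables w_i
  with i < j. There F is replaced by polynomials in w_j, ..., w_n that vanish along y and whose
  gradients combine to a multiple of the linearized operator, to any precision in x. That they exist
  is an algebraic fact of characteristic 0.\<close>

lemma mpoly_sum_monomials:
  fixes F :: "'a \<Rightarrow>\<^sub>0 'b::comm_monoid_add"
  assumes "finite A" "Poly_Mapping.keys F \<subseteq> A"
  shows "F = (\<Sum>m\<in>A. Poly_Mapping.single m (Poly_Mapping.lookup F m))"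
proof (rule poly_mapping_eqI)
  fix k
  have "(\<Sum>m\<in>A. Poly_Mapping.lookup (Poly_Mapping.single m (Poly_Mapping.lookup F m)) k)
      = (\<Sum>m\<in>A. if m = k then Poly_Mapping.lookup F m else 0)"
    by (intro sum.cong refl) (simp add: lookup_single when_def)
  also have "\<dots> = Poly_Mapping.lookup F k"
    using assms by (auto simp: in_keys_iff)
  finally show "Poly_Mapping.lookup F k
      = Poly_Mapping.lookup (\<Sum>m\<in>A. Poly_Mapping.single m (Poly_Mapping.lookup F m)) k"
    by (simp add: lookup_sum)
qed

lemma mpoly_monomial_induct [case_names zero monomial add]:
  fixes F :: "'a \<Rightarrow>\<^sub>0 'b::comm_monoid_add"
  assumes "P 0" "\<And>m. m \<in> Poly_Mapping.keys F \<Longrightarrow> P (Poly_Mapping.single m (Poly_Mapping.lookup F m))"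
    "\<And>G H. P G \<Longrightarrow> P H \<Longrightarrow> P (G + H)"
  shows "P F"
proof -
  have "P (\<Sum>m\<in>A. Poly_Mapping.single m (Poly_Mapping.lookup F m))"
    if "A \<subseteq> Poly_Mapping.keys F" "finite A" for A
    using that(2,1) by (induction A rule: finite_induct) (auto intro: assms)
  from this[of "Poly_Mapping.keys F"] show ?thesis
    using mpoly_sum_monomials[of "Poly_Mapping.keys F" F] by simp
qed

definition mvar :: "var \<Rightarrow> mpoly" where
  "mvar v = Poly_Mapping.single (Poly_Mapping.single v 1) 1"

lemma single_eq_prod_vars:
  "(Poly_Mapping.single m c :: mpoly)
   = Poly_Mapping.single 0 c * (\<Prod>v\<in>Poly_Mapping.keys m. mvar v ^ Poly_Mapping.lookup m v)"
proof -
  have pow: "mvar v ^ k = Poly_Mapping.single (Poly_Mapping.single v k) 1" for v k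
    by (induction k) (auto simp: mvar_def mult_single simp flip: single_add)
  have "(\<Prod>v\<in>A. mvar v ^ Poly_Mapping.lookup m v)
      = Poly_Mapping.single (\<Sum>v\<in>A. Poly_Mapping.single v (Poly_Mapping.lookup m v)) 1"
    if "finite A" for A
    using that by (induction A rule: finite_induct) (auto simp: pow mult_single)
  then show ?thesis
    using mpoly_sum_monomials[of "Poly_Mapping.keys m" m] by (simp add: mult_single)
qed

text \<open>A monomial is a constant times powers of variables that occur in \<open>F\<close>, so
  the induction never leaves \<open>S\<close>. It lifts facts from the ring generators while a
  restriction on the variables is kept.\<close>

lemma mpoly_ring_induct [consumes 1, case_names const var add mult]:
  fixes F :: mpoly
  assumes "vars F \<subseteq> S"
    and const: "\<And>c. P (Poly_Mapping.single 0 c)"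
    and var: "\<And>v. v \<in> S \<Longrightarrow> P (mvar v)"
    and add: "\<And>G H. P G \<Longrightarrow> P H \<Longrightarrow> P (G + H)"
    and mult: "\<And>G H. P G \<Longrightarrow> P H \<Longrightarrow> P (G * H)"
  shows "P F"
proof (induction F rule: mpoly_monomial_induct)
  case zero
  show ?case using const[of 0] by simp
next
  case (monomial m)
  have one: "P 1" using const[of 1] by simp
  have pow: "P (mvar v ^ k)" if "v \<in> S" for v k
    using that by (induction k) (auto intro: one mult var)
  have "P (\<Prod>v\<in>A. mvar v ^ Poly_Mapping.lookup m v)"
    if "A \<subseteq> Poly_Mapping.keys m" "finite A" for A
    using that(2,1)
  proof (induction A rule: finite_induct)
    case (insert v A)
    have "v \<in> S" using insert.prems monomial assms(1) by (auto simp: vars_def)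
    then show ?case using insert by (auto intro: mult pow)
  qed (auto intro: one)
  then show ?case
    by (subst single_eq_prod_vars) (auto intro!: mult const)
qed (rule add)

lemma vars_const [simp]: "vars (Poly_Mapping.single 0 c) = {}"
  by (simp add: vars_def)

lemma vars_mvar [simp]: "vars (mvar v) = {v}"
  by (simp add: vars_def mvar_def)

lemma vars_add: "vars (F + G) \<subseteq> vars F \<union> vars G"
  using keys_add[of F G] by (auto simp: vars_def)

lemma vars_uminus [simp]: "vars (- F) = vars F"
  by (simp add: vars_def)

lemma vars_mult: "vars (F * G) \<subseteq> vars F \<union> vars G"
proof
  fix v assume "v \<in> vars (F * G)"
  then obtain m where m: "m \<in> Poly_Mapping.keys (F * G)" "v \<in> Poly_Mapping.keys m"
    by (auto simp: vars_def)
  then obtain a b where "m = a + b" "a \<in> Poly_Mapping.keys F" "b \<in> Poly_Mapping.keys G"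
    using keys_mult[of F G] by blast
  then show "v \<in> vars F \<union> vars G"
    using m(2) keys_add[of a b] by (auto simp: vars_def)
qed

subsection \<open>Evaluation is a ring homomorphism\<close>

definition scalar :: "complex \<Rightarrow> ratfun" where
  "scalar c = Fract [:c:] 1"

lemma scalar_simps [simp]:
  "scalar 0 = 0" "scalar 1 = 1" "scalar (a + b) = scalar a + scalar b"
  "scalar (a * b) = scalar a * scalar b"
  by (simp_all add: scalar_def Zero_fract_def One_fract_def one_pCons mult.commute)

definition mono_value :: "ratfun fps \<Rightarrow> (var \<Rightarrow>\<^sub>0 nat) \<Rightarrow> ratfun fps" where
  "mono_value y m = (\<Prod>v\<in>Poly_Mapping.keys m. var_value y v ^ Poly_Mapping.lookup m v)"

lemma mono_value_superset:
  assumes "finite A" "Poly_Mapping.keys m \<subseteq> A"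
  shows "mono_value y m = (\<Prod>v\<in>A. var_value y v ^ Poly_Mapping.lookup m v)"
  unfolding mono_value_def using assms
  by (intro prod.mono_neutral_left) (auto simp: in_keys_iff)

lemma mono_value_add: "mono_value y (m + m') = mono_value y m * mono_value y m'"
proof -
  let ?A = "Poly_Mapping.keys m \<union> Poly_Mapping.keys m'"
  have "mono_value y k = (\<Prod>v\<in>?A. var_value y v ^ Poly_Mapping.lookup k v)"
    if "Poly_Mapping.keys k \<subseteq> ?A" for k
    using that by (intro mono_value_superset) auto
  then show ?thesis
    using keys_add[of m m'] by (simp add: lookup_add power_add prod.distrib)
qed

lemma eval_along_superset:
  assumes "finite A" "Poly_Mapping.keys F \<subseteq> A"
  shows "eval_along F y
    = (\<Sum>m\<in>A. fps_const (scalar (Poly_Mapping.lookup F m)) * mono_value y m)"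
  unfolding eval_along_def mono_value_def scalar_def[symmetric] using assms
  by (intro sum.mono_neutral_left) (auto simp: in_keys_iff)

lemma eval_along_add: "eval_along (F + G) y = eval_along F y + eval_along G y"
proof -
  let ?A = "Poly_Mapping.keys F \<union> Poly_Mapping.keys G"
  have "eval_along H y = (\<Sum>m\<in>?A. fps_const (scalar (Poly_Mapping.lookup H m)) * mono_value y m)"
    if "Poly_Mapping.keys H \<subseteq> ?A" for H
    using that by (intro eval_along_superset) auto
  then show ?thesis
    using keys_add[of F G]
    by (simp add: lookup_add distrib_right sum.distrib flip: fps_const_add)
qed

lemma eval_along_single:
  "eval_along (Poly_Mapping.single m c) y = fps_const (scalar c) * mono_value y m"
  by (auto simp: eval_along_def mono_value_def simp flip: scalar_def)

lemma eval_along_0 [simp]: "eval_along 0 y = 0"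
  by (simp add: eval_along_def)

lemma eval_along_const [simp]: "eval_along (Poly_Mapping.single 0 c) y = fps_const (scalar c)"
  by (simp add: eval_along_single mono_value_def)

lemma eval_along_1 [simp]: "eval_along 1 y = 1"
  using eval_along_const[of 1 y] by simp

lemma eval_along_mvar [simp]: "eval_along (mvar v) y = var_value y v"
  by (simp add: mvar_def eval_along_single mono_value_def)

lemma eval_along_mult: "eval_along (F * G) y = eval_along F y * eval_along G y"
proof (induction F rule: mpoly_monomial_induct)
  case (monomial m)
  let ?c = "Poly_Mapping.lookup F m"
  show ?case
  proof (induction G rule: mpoly_monomial_induct)
    case (monomial k)
    show ?case
      by (simp add: mult_single eval_along_single mono_value_add mult_ac flip: fps_const_mult)
  qed (simp_all add: eval_along_add algebra_simps)
qed (simp_all add: eval_along_add algebra_simps)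

lemma eval_along_uminus: "eval_along (- F) y = - eval_along F y"
  using eval_along_add[of F "- F" y] by (simp add: eq_neg_iff_add_eq_0 add.commute)

lemma eval_along_diff: "eval_along (F - G) y = eval_along F y - eval_along G y"
  using eval_along_add[of F "- G" y] by (simp add: eval_along_uminus)

subsection \<open>Partial derivatives are derivations\<close>

lemma partial_deriv_superset:
  assumes "finite A" "Poly_Mapping.keys F \<subseteq> A"
  shows "partial_deriv v F = (\<Sum>m\<in>A. Poly_Mapping.single (m - Poly_Mapping.single v 1)
       (of_nat (Poly_Mapping.lookup m v) * Poly_Mapping.lookup F m))"
  unfolding partial_deriv_def using assms
  by (intro sum.mono_neutral_left) (auto simp: in_keys_iff)

lemma partial_deriv_add: "partial_deriv v (F + G) = partial_deriv v F + partial_deriv v G"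
proof -
  let ?A = "Poly_Mapping.keys F \<union> Poly_Mapping.keys G"
  have "partial_deriv v H = (\<Sum>m\<in>?A. Poly_Mapping.single (m - Poly_Mapping.single v 1)
       (of_nat (Poly_Mapping.lookup m v) * Poly_Mapping.lookup H m))"
    if "Poly_Mapping.keys H \<subseteq> ?A" for H
    using that by (intro partial_deriv_superset) auto
  then show ?thesis
    using keys_add[of F G]
    by (simp add: lookup_add distrib_left sum.distrib single_add)
qed

lemma partial_deriv_single:
  "partial_deriv v (Poly_Mapping.single m c)
   = Poly_Mapping.single (m - Poly_Mapping.single v 1) (of_nat (Poly_Mapping.lookup m v) * c)"
  by (simp add: partial_deriv_def)

lemma partial_deriv_0 [simp]: "partial_deriv v 0 = 0"
  by (simp add: partial_deriv_def)

lemma partial_deriv_const [simp]: "partial_deriv v (Poly_Mapping.single 0 c) = 0"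
  by (simp add: partial_deriv_single)

lemma partial_deriv_mvar: "partial_deriv v (mvar u) = (if u = v then 1 else 0)"
  by (simp add: mvar_def partial_deriv_single lookup_single when_def)

lemma partial_deriv_mult:
  "partial_deriv v (F * G) = partial_deriv v F * G + F * partial_deriv v G"
proof (induction F rule: mpoly_monomial_induct)
  case (monomial m)
  let ?a = "Poly_Mapping.lookup F m"
  show ?case
  proof (induction G rule: mpoly_monomial_induct)
    case (monomial k)
    let ?e = "Poly_Mapping.single v (1::nat)" and ?b = "Poly_Mapping.lookup G k"
    \<comment> \<open>Subtraction of exponents is truncated, so the shift is valid only if
      \<open>v\<close> occurs in \<open>l\<close>. If it does not occur, the multiplicity factor is
      zero and both monomials vanish.\<close>
    have shift: "l - ?e + l' = l + l' - ?e" if "Poly_Mapping.lookup l v \<noteq> 0" for l l'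
      using that by (intro poly_mapping_eqI) (auto simp: lookup_add lookup_minus lookup_single when_def)
    have l: "Poly_Mapping.single (m - ?e + k) (of_nat (Poly_Mapping.lookup m v) * (?a * ?b))
        = Poly_Mapping.single (m + k - ?e) (of_nat (Poly_Mapping.lookup m v) * (?a * ?b))"
      using shift[of m k] by (cases "Poly_Mapping.lookup m v = 0") auto
    have r: "Poly_Mapping.single (m + (k - ?e)) (of_nat (Poly_Mapping.lookup k v) * (?a * ?b))
        = Poly_Mapping.single (m + k - ?e) (of_nat (Poly_Mapping.lookup k v) * (?a * ?b))"
      using shift[of k m] by (cases "Poly_Mapping.lookup k v = 0") (auto simp: add.commute)
    have "partial_deriv v (Poly_Mapping.single m ?a * Poly_Mapping.single k ?b)
        = Poly_Mapping.single (m + k - ?e) (of_nat (Poly_Mapping.lookup m v) * (?a * ?b))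
        + Poly_Mapping.single (m + k - ?e) (of_nat (Poly_Mapping.lookup k v) * (?a * ?b))"
      by (simp only: mult_single partial_deriv_single lookup_add of_nat_add distrib_right single_add)
    then show ?case
      unfolding l[symmetric] r[symmetric]
      by (simp only: mult_single partial_deriv_single mult.assoc mult.left_commute[of _ ?a])
  qed (simp_all add: partial_deriv_add algebra_simps)
qed (simp_all add: partial_deriv_add algebra_simps)

lemma partial_deriv_not_in_vars:
  assumes "v \<notin> vars F"
  shows "partial_deriv v F = 0"
  unfolding partial_deriv_def
proof (rule sum.neutral, safe)
  fix m assume "m \<in> Poly_Mapping.keys F"
  then have "Poly_Mapping.lookup m v = 0"
    using assms by (auto simp: vars_def in_keys_iff)
  then show "Poly_Mapping.single (m - Poly_Mapping.single v 1)
       (of_nat (Poly_Mapping.lookup m v) * Poly_Mapping.lookup F m) = 0" by simp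
qed

subsection \<open>Polynomial functionals and their Taylor expansion\<close>

lemma dilate_nth [simp]: "fps_nth (dilate i y) h = qvar ^ (i * h) * fps_nth y h"
  by (simp add: dilate_def)

lemma dilate_add: "dilate i (y + z) = dilate i y + dilate i z"
  by (rule fps_ext) (simp add: algebra_simps)

section \<open>Divisibility by powers of x, and power series that are polynomials in x\<close>

definition lowzero :: "nat \<Rightarrow> 'a::comm_ring_1 fps \<Rightarrow> bool" where
  "lowzero N f \<longleftrightarrow> (\<forall>h<N. fps_nth f h = 0)"

lemma lowzero_0 [simp]: "lowzero N 0"
  and lowzero_0_left [simp]: "lowzero 0 f"
  by (simp_all add: lowzero_def)

lemma lowzero_add: "lowzero N f \<Longrightarrow> lowzero N g \<Longrightarrow> lowzero N (f + g)"
  by (simp add: lowzero_def)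

lemma lowzero_mono: "lowzero N f \<Longrightarrow> M \<le> N \<Longrightarrow> lowzero M f"
  by (simp add: lowzero_def)

lemma lowzero_mult:
  assumes "lowzero M f" "lowzero N g"
  shows "lowzero (M + N) (f * g)"
  unfolding lowzero_def fps_mult_nth
proof (intro allI impI sum.neutral ballI)
  fix h i assume "h < M + N" "i \<in> {0..h}"
  then have "i < M \<or> h - i < N" by auto
  then show "fps_nth f i * fps_nth g (h - i) = 0"
    using assms by (auto simp: lowzero_def)
qed

lemma lowzero_mult_left: "lowzero N g \<Longrightarrow> lowzero N (f * g)"
  using lowzero_mult[of 0 f N g] by simp

lemma lowzero_mult_right: "lowzero N f \<Longrightarrow> lowzero N (f * g)"
  using lowzero_mult[of N f 0 g] by simp

lemma lowzero_diff_mult: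
  assumes "lowzero N (a - b)" "lowzero N (c - d)"
  shows "lowzero N (a * c - b * d)"
proof -
  have "a * c - b * d = (a - b) * c + b * (c - d)" by (simp add: algebra_simps)
  then show ?thesis
    using assms by (simp add: lowzero_add lowzero_mult_left lowzero_mult_right)
qed

lemma lowzero_diff_add:
  assumes "lowzero N (a - b)" "lowzero N (c - d)"
  shows "lowzero N (a + c - (b + d))"
  using assms by (auto simp: lowzero_def)

text \<open>Finite support is what bounds a valuation on all coefficients at once; a general series
  over C(q) admits no such bound.\<close>

definition fin_supp :: "'a::comm_ring_1 fps \<Rightarrow> bool" where
  "fin_supp f \<longleftrightarrow> (\<exists>N. \<forall>h\<ge>N. fps_nth f h = 0)"

lemma fin_supp_0 [simp]: "fin_supp 0"
  by (simp add: fin_supp_def)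

lemma fin_supp_const [simp]: "fin_supp (fps_const c)"
  by (auto simp: fin_supp_def intro!: exI[of _ 1])

lemma fin_supp_1 [simp]: "fin_supp 1"
  using fin_supp_const[of 1] by simp

lemma fin_supp_X [simp]: "fin_supp fps_X"
  by (auto simp: fin_supp_def fps_X_def intro!: exI[of _ 2])

lemma fin_supp_add: "fin_supp f \<Longrightarrow> fin_supp g \<Longrightarrow> fin_supp (f + g)"
  unfolding fin_supp_def by (metis add_0 fps_add_nth le_trans linorder_le_cases)

lemma fin_supp_mult:
  assumes "fin_supp f" "fin_supp g"
  shows "fin_supp (f * g)"
proof -
  obtain M N where MN: "\<And>h. h \<ge> M \<Longrightarrow> fps_nth f h = 0" "\<And>h. h \<ge> N \<Longrightarrow> fps_nth g h = 0"
    using assms by (auto simp: fin_supp_def)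
  have "fps_nth (f * g) h = 0" if "h \<ge> M + N" for h
    unfolding fps_mult_nth
  proof (intro sum.neutral ballI)
    fix i assume "i \<in> {0..h}"
    then have "i \<ge> M \<or> h - i \<ge> N" using that by auto
    then show "fps_nth f i * fps_nth g (h - i) = 0" using MN by auto
  qed
  then show ?thesis by (auto simp: fin_supp_def)
qed

lemma fin_supp_dilate: "fin_supp f \<Longrightarrow> fin_supp (dilate i f)"
  by (auto simp: fin_supp_def)

lemma fin_supp_cutoff [simp]: "fin_supp (fps_cutoff N f)"
  by (auto simp: fin_supp_def intro!: exI[of _ N])

lemma lowzero_cutoff: "lowzero N (fps_cutoff N f - f)"
  by (simp add: lowzero_def)

text \<open>\<open>\<Phi>\<close> is a polynomial with coefficients in \<open>C(q)[x]\<close> evaluated along the dilates with index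
  in \<open>J\<close>, and \<open>d\<Phi> i\<close> is its partial derivative with respect to the \<open>i\<close>-th dilate.\<close>

inductive polyop :: "nat set \<Rightarrow> (ratfun fps \<Rightarrow> ratfun fps) \<Rightarrow> (nat \<Rightarrow> ratfun fps \<Rightarrow> ratfun fps) \<Rightarrow> bool"
  for J where
  const: "fin_supp c \<Longrightarrow> polyop J (\<lambda>_. c) (\<lambda>_ _. 0)"
| dil: "i \<in> J \<Longrightarrow> polyop J (dilate i) (\<lambda>k _. if k = i then 1 else 0)"
| add: "polyop J \<Phi> d\<Phi> \<Longrightarrow> polyop J \<Psi> d\<Psi> \<Longrightarrow>
    polyop J (\<lambda>y. \<Phi> y + \<Psi> y) (\<lambda>k y. d\<Phi> k y + d\<Psi> k y)"
| mult: "polyop J \<Phi> d\<Phi> \<Longrightarrow> polyop J \<Psi> d\<Psi> \<Longrightarrow>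
    polyop J (\<lambda>y. \<Phi> y * \<Psi> y) (\<lambda>k y. d\<Phi> k y * \<Psi> y + \<Phi> y * d\<Psi> k y)"

lemma polyop_scale:
  assumes "fin_supp c" "polyop J \<Phi> d\<Phi>"
  shows "polyop J (\<lambda>y. c * \<Phi> y) (\<lambda>k y. c * d\<Phi> k y)"
  using polyop.mult[OF polyop.const[OF assms(1)] assms(2)] by simp

lemma polyop_eval_along:
  assumes "vars F \<subseteq> {Var_q, Var_x} \<union> Var_w ` J"
  shows "polyop J (eval_along F) (\<lambda>i. eval_along (partial_deriv (Var_w i) F))"
  using assms
proof (induction F rule: mpoly_ring_induct)
  case (const c)
  have "polyop J (\<lambda>_. fps_const (scalar c)) (\<lambda>_ _. 0)" by (rule polyop.const) simp
  then show ?case by (simp add: fun_eq_iff)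
next
  case (var v)
  consider "v = Var_q" | "v = Var_x" | i where "v = Var_w i" "i \<in> J" using var by auto
  then show ?case
  proof cases
    case 1
    have "polyop J (\<lambda>_. fps_const qvar) (\<lambda>_ _. 0)" by (rule polyop.const) simp
    then show ?thesis using 1 by (simp add: partial_deriv_mvar)
  next
    case 2
    have "polyop J (\<lambda>_. fps_X) (\<lambda>_ _. 0)" by (rule polyop.const) simp
    then show ?thesis using 2 by (simp add: partial_deriv_mvar)
  next
    case 3
    have "(\<lambda>k. eval_along (partial_deriv (Var_w k) (mvar v))) = (\<lambda>k _. if k = i then 1 else 0)"
      using 3 by (auto simp: partial_deriv_mvar fun_eq_iff)
    then show ?thesis using polyop.dil[OF 3(2)] 3 by simp
  qed
next
  case (add G H)
  then show ?case using polyop.add by (simp add: eval_along_add partial_deriv_add)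
next
  case (mult G H)
  then show ?case
    using polyop.mult by (simp add: eval_along_add eval_along_mult partial_deriv_mult)
qed

lemma polyop_fin_supp:
  assumes "polyop J \<Phi> d\<Phi>" "fin_supp p"
  shows "fin_supp (\<Phi> p) \<and> (\<forall>k. fin_supp (d\<Phi> k p))"
  using assms by (induction rule: polyop.induct) (auto intro: fin_supp_add fin_supp_mult fin_supp_dilate)

text \<open>Congruence modulo x^N respects sums and products, and a dilate acts on each coefficient
  separately.\<close>

lemma polyop_cong_low:
  assumes "polyop J \<Phi> d\<Phi>" "lowzero N (p - y)"
  shows "lowzero N (\<Phi> p - \<Phi> y) \<and> (\<forall>k. lowzero N (d\<Phi> k p - d\<Phi> k y))"
  using assms
proof (induction rule: polyop.induct)
  case (dil i)
  then show ?case by (simp add: lowzero_def)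
qed (auto intro: lowzero_diff_add lowzero_diff_mult)

text \<open>The index \<open>\<iota>\<close> lets one filtration express bounds that are uniform over a family of series.\<close>

locale series_filtration =
  fixes B :: "nat \<Rightarrow> ('i \<Rightarrow> ratfun fps) \<Rightarrow> bool"
  assumes B_const: "fin_supp c \<Longrightarrow> B 0 (\<lambda>_. c)"
    and B_zero: "B d (\<lambda>_. 0)"
    and B_add: "B d f \<Longrightarrow> B d g \<Longrightarrow> B d (\<lambda>\<iota>. f \<iota> + g \<iota>)"
    and B_mult: "B d f \<Longrightarrow> B e g \<Longrightarrow> B (d + e) (\<lambda>\<iota>. f \<iota> * g \<iota>)"
    and B_Suc: "B (Suc d) f \<Longrightarrow> B d f"
begin

lemma B_sum: "(\<And>i. i \<in> A \<Longrightarrow> B d (f i)) \<Longrightarrow> B d (\<lambda>\<iota>. \<Sum>i\<in>A. f i \<iota>)"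
  by (induction A rule: infinite_finite_induct) (auto intro: B_zero B_add)

lemma B_0:
  assumes "B d f"
  shows "B 0 f"
  using assms by (induction d) (auto intro: B_Suc)

text \<open>The increment has level 1, so whatever is quadratic in it has level 2. In a product of
  two expansions the new remainder consists of the product of the linear parts and of terms
  containing an old remainder. The filtration stays abstract because the expansion is needed twice,
  for powers of x and for growth bounds.\<close>

lemma polyop_taylor:
  assumes "polyop J \<Phi> d\<Phi>" "finite J"
    and Y: "\<And>i. i \<in> J \<Longrightarrow> B 0 (\<lambda>\<iota>. dilate i (Y \<iota>))"
    and Z: "\<And>i. i \<in> J \<Longrightarrow> B 1 (\<lambda>\<iota>. dilate i (Z \<iota>))"
  shows "B 0 (\<lambda>\<iota>. \<Phi> (Y \<iota>)) \<and> (\<forall>k. B 0 (\<lambda>\<iota>. d\<Phi> k (Y \<iota>))) \<and>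
    B 2 (\<lambda>\<iota>. \<Phi> (Y \<iota> + Z \<iota>) - \<Phi> (Y \<iota>) - (\<Sum>k\<in>J. d\<Phi> k (Y \<iota>) * dilate k (Z \<iota>)))"
  using assms(1)
proof (induction rule: polyop.induct)
  case (const c)
  then show ?case by (auto intro: B_const B_zero)
next
  case (dil i)
  have "B 0 (\<lambda>_. 1)" by (rule B_const) simp
  moreover have "dilate i (u + z) - dilate i u - (\<Sum>k\<in>J. (if k = i then 1 else 0) * dilate k z) = 0"
    for u z
    using dil assms(2) by (simp add: dilate_add if_distrib[of "\<lambda>t. t * _"] cong: if_cong)
  ultimately show ?case using dil Y by (auto intro: B_zero)
next
  case (add \<Phi> d\<Phi> \<Psi> d\<Psi>)
  have eq: "\<Phi> (Y \<iota> + Z \<iota>) + \<Psi> (Y \<iota> + Z \<iota>) - (\<Phi> (Y \<iota>) + \<Psi> (Y \<iota>))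
      - (\<Sum>k\<in>J. (d\<Phi> k (Y \<iota>) + d\<Psi> k (Y \<iota>)) * dilate k (Z \<iota>))
    = (\<Phi> (Y \<iota> + Z \<iota>) - \<Phi> (Y \<iota>) - (\<Sum>k\<in>J. d\<Phi> k (Y \<iota>) * dilate k (Z \<iota>)))
    + (\<Psi> (Y \<iota> + Z \<iota>) - \<Psi> (Y \<iota>) - (\<Sum>k\<in>J. d\<Psi> k (Y \<iota>) * dilate k (Z \<iota>)))" for \<iota>
    by (simp add: algebra_simps sum.distrib)
  show ?case unfolding eq using add.IH by (auto intro!: B_add)
next
  case (mult \<Phi> d\<Phi> \<Psi> d\<Psi>)
  define DF where "DF = (\<lambda>\<iota>. \<Sum>k\<in>J. d\<Phi> k (Y \<iota>) * dilate k (Z \<iota>))"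
  define DG where "DG = (\<lambda>\<iota>. \<Sum>k\<in>J. d\<Psi> k (Y \<iota>) * dilate k (Z \<iota>))"
  define RF where "RF = (\<lambda>\<iota>. \<Phi> (Y \<iota> + Z \<iota>) - \<Phi> (Y \<iota>) - DF \<iota>)"
  define RG where "RG = (\<lambda>\<iota>. \<Psi> (Y \<iota> + Z \<iota>) - \<Psi> (Y \<iota>) - DG \<iota>)"
  have D: "B 1 DF" "B 1 DG"
    unfolding DF_def DG_def using mult.IH Z B_mult[of 0 _ 1] by (auto intro!: B_sum)
  have D0: "B 0 DF" using D(1) by (rule B_0)
  have R: "B 2 RF" "B 2 RG" unfolding RF_def RG_def DF_def DG_def using mult.IH by auto
  have B0: "B 0 (\<lambda>\<iota>. \<Phi> (Y \<iota>))" "B 0 (\<lambda>\<iota>. \<Psi> (Y \<iota>))" "\<And>k. B 0 (\<lambda>\<iota>. d\<Phi> k (Y \<iota>))" "\<And>k. B 0 (\<lambda>\<iota>. d\<Psi> k (Y \<iota>))"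
    using mult.IH by auto
  have B0G: "B 0 (\<lambda>\<iota>. \<Psi> (Y \<iota>) + DG \<iota> + RG \<iota>)"
    using B0 D R by (auto intro!: B_add intro: B_0)
  have eq: "\<Phi> (Y \<iota> + Z \<iota>) * \<Psi> (Y \<iota> + Z \<iota>) - \<Phi> (Y \<iota>) * \<Psi> (Y \<iota>)
      - (\<Sum>k\<in>J. (d\<Phi> k (Y \<iota>) * \<Psi> (Y \<iota>) + \<Phi> (Y \<iota>) * d\<Psi> k (Y \<iota>)) * dilate k (Z \<iota>))
    = DF \<iota> * DG \<iota> + (RF \<iota> * (\<Psi> (Y \<iota>) + DG \<iota> + RG \<iota>) + (\<Phi> (Y \<iota>) + DF \<iota>) * RG \<iota>)" for \<iota>
  proof -
    have s: "(\<Sum>k\<in>J. (d\<Phi> k (Y \<iota>) * \<Psi> (Y \<iota>) + \<Phi> (Y \<iota>) * d\<Psi> k (Y \<iota>)) * dilate k (Z \<iota>))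
        = DF \<iota> * \<Psi> (Y \<iota>) + \<Phi> (Y \<iota>) * DG \<iota>"
      unfolding DF_def DG_def
      by (simp add: sum_distrib_left sum_distrib_right algebra_simps flip: sum.distrib)
    have F: "\<Phi> (Y \<iota> + Z \<iota>) = \<Phi> (Y \<iota>) + DF \<iota> + RF \<iota>" "\<Psi> (Y \<iota> + Z \<iota>) = \<Psi> (Y \<iota>) + DG \<iota> + RG \<iota>"
      by (simp_all add: RF_def RG_def)
    show ?thesis unfolding s F by (simp add: algebra_simps)
  qed
  have "B 2 (\<lambda>\<iota>. DF \<iota> * DG \<iota>)" using B_mult[OF D] by (simp add: numeral_2_eq_2)
  moreover have "B 2 (\<lambda>\<iota>. RF \<iota> * (\<Psi> (Y \<iota>) + DG \<iota> + RG \<iota>))" using B_mult[OF R(1) B0G] by simp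
  moreover have "B 2 (\<lambda>\<iota>. (\<Phi> (Y \<iota>) + DF \<iota>) * RG \<iota>)"
    using B_mult[OF B_add[OF B0(1) D0] R(2)] by (simp add: numeral_2_eq_2)
  ultimately have "B 2 (\<lambda>\<iota>. DF \<iota> * DG \<iota> + (RF \<iota> * (\<Psi> (Y \<iota>) + DG \<iota> + RG \<iota>) + (\<Phi> (Y \<iota>) + DF \<iota>) * RG \<iota>))"
    by (intro B_add)
  moreover have "B 0 (\<lambda>\<iota>. \<Phi> (Y \<iota>) * \<Psi> (Y \<iota>))"
    "\<And>k. B 0 (\<lambda>\<iota>. d\<Phi> k (Y \<iota>) * \<Psi> (Y \<iota>) + \<Phi> (Y \<iota>) * d\<Psi> k (Y \<iota>))"
    using B_mult[of 0 _ 0] B0 by (auto intro!: B_add)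
  ultimately show ?case unfolding eq by blast
qed

end

lemma series_filtration_lowzero:
  "series_filtration (\<lambda>d f. lowzero (d * N) (f (u::unit)))"
proof
  fix d :: nat and f :: "unit \<Rightarrow> ratfun fps"
  assume "lowzero (Suc d * N) (f u)"
  then show "lowzero (d * N) (f u)" by (rule lowzero_mono) simp
qed (auto intro: lowzero_add simp: lowzero_mult distrib_right)

lemma polyop_taylor_lowzero:
  assumes "polyop J \<Phi> d\<Phi>" "finite J" "lowzero N z"
  shows "lowzero (2 * N) (\<Phi> (y + z) - \<Phi> y - (\<Sum>k\<in>J. d\<Phi> k y * dilate k z))"
proof -
  interpret series_filtration "\<lambda>d f. lowzero (d * N) (f ())" by (rule series_filtration_lowzero)
  show ?thesis
    using polyop_taylor[OF assms(1,2), of "\<lambda>_. y" "\<lambda>_. z"] assms(3) by (auto simp: lowzero_def)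
qed

subsection \<open>Valuations and growth of the coefficients\<close>

lemma qvar_nonzero [simp]: "qvar \<noteq> 0"
  by (simp add: qvar_def Zero_fract_def eq_fract)

text \<open>The logarithm of a non-archimedean absolute value. It is real-valued, so its value at 0
  carries no information; hence the guards here and the separate treatment of 0 in
  \<open>vle\<close>.\<close>

locale q_valuation =
  fixes \<delta> :: "ratfun \<Rightarrow> real" and \<epsilon> :: real
  assumes val_mult: "a \<noteq> 0 \<Longrightarrow> b \<noteq> 0 \<Longrightarrow> \<delta> (a * b) = \<delta> a + \<delta> b"
    and val_add: "a \<noteq> 0 \<Longrightarrow> b \<noteq> 0 \<Longrightarrow> a + b \<noteq> 0 \<Longrightarrow> \<delta> (a + b) \<le> max (\<delta> a) (\<delta> b)"
    and val_q: "\<delta> qvar = \<epsilon>"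
begin

definition vle :: "ratfun \<Rightarrow> real \<Rightarrow> bool" where
  "vle a c \<longleftrightarrow> a = 0 \<or> \<delta> a \<le> c"

lemma vle_0 [simp]: "vle 0 c"
  by (simp add: vle_def)

lemma vle_self: "vle a (\<delta> a)"
  by (simp add: vle_def)

lemma vle_mono: "vle a c \<Longrightarrow> c \<le> d \<Longrightarrow> vle a d"
  by (auto simp: vle_def)

lemma vle_add: "vle a c \<Longrightarrow> vle b c \<Longrightarrow> vle (a + b) c"
  using val_add[of a b] by (cases "a = 0 \<or> b = 0 \<or> a + b = 0") (auto simp: vle_def)

lemma vle_mult: "vle a c \<Longrightarrow> vle b d \<Longrightarrow> vle (a * b) (c + d)"
  using val_mult[of a b] by (cases "a = 0 \<or> b = 0") (auto simp: vle_def)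

lemma vle_sum: "(\<And>i. i \<in> A \<Longrightarrow> vle (f i) c) \<Longrightarrow> vle (sum f A) c"
  by (induction A rule: infinite_finite_induct) (auto intro: vle_add)

lemma val_1 [simp]: "\<delta> 1 = 0"
  using val_mult[of 1 1] by simp

lemma val_minus_1 [simp]: "\<delta> (- 1) = 0"
  using val_mult[of "- 1" "- 1"] by simp

lemma val_uminus [simp]: "\<delta> (- a) = \<delta> a"
  using val_mult[of "- 1" a] by (cases "a = 0") auto

lemma vle_uminus [simp]: "vle (- a) c \<longleftrightarrow> vle a c"
  by (simp add: vle_def)

lemma val_q_power: "\<delta> (qvar ^ k) = \<epsilon> * real k"
  by (induction k) (simp_all add: val_mult val_q algebra_simps)

lemma vle_q_power_mult: "vle a c \<Longrightarrow> vle (qvar ^ k * a) (\<epsilon> * real k + c)"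
  using vle_mult[OF vle_self[of "qvar ^ k"]] by (simp add: val_q_power)

text \<open>The ultrametric inequality for \<open>a = (a + b) + (- b)\<close> bounds
  \<open>\<delta> a\<close> by the larger of \<open>\<delta> (a + b)\<close> and
  \<open>\<delta> b\<close>, and the second is too small.\<close>

lemma val_dominant:
  assumes "a \<noteq> 0" "b = 0 \<or> \<delta> b < \<delta> a"
  shows "a + b \<noteq> 0 \<and> \<delta> a \<le> \<delta> (a + b)"
proof (cases "b = 0")
  case False
  have ne: "a + b \<noteq> 0"
  proof
    assume "a + b = 0"
    then have "a = - b" by (simp add: eq_neg_iff_add_eq_0)
    then show False using assms False by simp
  qed
  then show ?thesis
    using val_add[of "a + b" "- b"] assms False by auto
qed (use assms in auto)

lemma val_sum_less:
  assumes "\<And>i. i \<in> A \<Longrightarrow> f i = 0 \<or> \<delta> (f i) < c"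
  shows "sum f A = 0 \<or> \<delta> (sum f A) < c"
  using assms
proof (induction A rule: infinite_finite_induct)
  case (insert i A)
  then show ?case
    using val_add[of "f i" "sum f A"] by (cases "f i = 0"; cases "sum f A = 0") force+
qed auto

text \<open>The lead of the term at \<open>j\<close> over any other nonzero term grows linearly in
  \<open>h\<close>, so it eventually beats the fixed difference of the values of the
  coefficients.\<close>

lemma val_leading_sum:
  assumes "finite J" "j \<in> J" "A j \<noteq> 0"
    and less: "\<And>i. i \<in> J \<Longrightarrow> i \<noteq> j \<Longrightarrow> A i \<noteq> 0 \<Longrightarrow> \<epsilon> * real i < \<epsilon> * real j"
  shows "eventually (\<lambda>h. (\<Sum>i\<in>J. A i * qvar ^ (i * h)) \<noteq> 0 \<and>
    \<epsilon> * real j * real h + \<delta> (A j) \<le> \<delta> (\<Sum>i\<in>J. A i * qvar ^ (i * h))) sequentially"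
proof -
  have "eventually (\<lambda>h. A i = 0 \<or> \<delta> (A i) + \<epsilon> * real (i * h) < \<delta> (A j) + \<epsilon> * real (j * h)) sequentially"
    if i: "i \<in> J - {j}" for i
  proof (cases "A i = 0")
    case False
    let ?d = "\<epsilon> * real j - \<epsilon> * real i"
    have d: "?d > 0" using less[of i] i False by auto
    then obtain n where n: "\<delta> (A i) - \<delta> (A j) < real n * ?d"
      using reals_Archimedean3 by blast
    have "\<delta> (A i) + \<epsilon> * real (i * h) < \<delta> (A j) + \<epsilon> * real (j * h)" if "h \<ge> n" for h
    proof -
      have "real n * ?d \<le> real h * ?d" using that d by (intro mult_right_mono) auto
      then show ?thesis using n by (simp add: algebra_simps)
    qed
    then show ?thesis by (auto simp: eventually_sequentially)
  qed auto
  then have "eventually (\<lambda>h. \<forall>i\<in>J-{j}. A i = 0 \<or>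
      \<delta> (A i) + \<epsilon> * real (i * h) < \<delta> (A j) + \<epsilon> * real (j * h)) sequentially"
    using assms(1) by (intro eventually_ball_finite) auto
  then show ?thesis
  proof (rule eventually_mono)
    fix h assume h: "\<forall>i\<in>J-{j}. A i = 0 \<or> \<delta> (A i) + \<epsilon> * real (i * h) < \<delta> (A j) + \<epsilon> * real (j * h)"
    have v: "\<delta> (A i * qvar ^ (i * h)) = \<delta> (A i) + \<epsilon> * real (i * h)" if "A i \<noteq> 0" for i
      using that val_q_power[of "i * h"] by (simp add: val_mult)
    have "(\<Sum>i\<in>J-{j}. A i * qvar ^ (i * h)) = 0 \<or>
        \<delta> (\<Sum>i\<in>J-{j}. A i * qvar ^ (i * h)) < \<delta> (A j * qvar ^ (j * h))"
    proof (rule val_sum_less)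
      fix i assume "i \<in> J - {j}"
      then show "A i * qvar ^ (i * h) = 0 \<or> \<delta> (A i * qvar ^ (i * h)) < \<delta> (A j * qvar ^ (j * h))"
        using h v[of i] v[of j] assms(3) by (cases "A i = 0") auto
    qed
    then have "A j * qvar ^ (j * h) + (\<Sum>i\<in>J-{j}. A i * qvar ^ (i * h)) \<noteq> 0 \<and>
        \<delta> (A j * qvar ^ (j * h)) \<le> \<delta> (A j * qvar ^ (j * h) + (\<Sum>i\<in>J-{j}. A i * qvar ^ (i * h)))"
      using assms(3) by (intro val_dominant) auto
    moreover have "(\<Sum>i\<in>J. A i * qvar ^ (i * h))
        = A j * qvar ^ (j * h) + (\<Sum>i\<in>J-{j}. A i * qvar ^ (i * h))"
      using assms(1,2) by (rule sum.remove)
    ultimately show "(\<Sum>i\<in>J. A i * qvar ^ (i * h)) \<noteq> 0 \<and>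
        \<epsilon> * real j * real h + \<delta> (A j) \<le> \<delta> (\<Sum>i\<in>J. A i * qvar ^ (i * h))"
      using v[of j] assms(3) by (simp add: algebra_simps)
  qed
qed

lemma fin_supp_bound:
  assumes "fin_supp f"
  obtains C where "C \<ge> 0" "\<And>h. vle (fps_nth f h) C"
proof -
  obtain N where N: "\<And>h. h \<ge> N \<Longrightarrow> fps_nth f h = 0"
    using assms by (auto simp: fin_supp_def)
  have "vle (fps_nth f h) (\<Sum>k<N. \<bar>\<delta> (fps_nth f k)\<bar>)" for h
  proof (cases "h < N")
    case True
    then have "\<bar>\<delta> (fps_nth f h)\<bar> \<le> (\<Sum>k<N. \<bar>\<delta> (fps_nth f k)\<bar>)"
      by (intro member_le_sum) auto
    then show ?thesis by (auto simp: vle_def)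
  qed (simp add: N)
  then show ?thesis by (intro that[of "\<Sum>k<N. \<bar>\<delta> (fps_nth f k)\<bar>"]) (auto intro: sum_nonneg)
qed

section \<open>Quadratic growth bounds as a filtration\<close>

definition gr :: "real \<Rightarrow> real \<Rightarrow> real \<Rightarrow> real" where
  "gr s C x = s * x\<^sup>2 / 2 + C * x"

lemma gr_mono: "s \<ge> 0 \<Longrightarrow> C \<ge> 0 \<Longrightarrow> 0 \<le> x \<Longrightarrow> x \<le> z \<Longrightarrow> gr s C x \<le> gr s C z"
  unfolding gr_def by (intro add_mono mult_left_mono divide_right_mono power_mono) auto

lemma gr_nonneg: "s \<ge> 0 \<Longrightarrow> C \<ge> 0 \<Longrightarrow> 0 \<le> x \<Longrightarrow> 0 \<le> gr s C x"
  unfolding gr_def by simp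

text \<open>The cross term of the square is nonnegative and \<open>gr\<close> has no constant term.
  This is what carries growth bounds through Cauchy products.\<close>

lemma gr_superadditive:
  assumes "s \<ge> 0" "0 \<le> x" "0 \<le> z"
  shows "gr s C x + gr s C z \<le> gr s C (x + z)"
proof -
  have "0 \<le> s * (x * z)" using assms by simp
  then show ?thesis by (simp add: gr_def power2_eq_square field_simps)
qed

text \<open>The induction hypothesis for the coefficients strictly between \<open>M\<close> and
  \<open>H\<close>, with a constant \<open>C\<close> that is still to be chosen. Nonnegativity of
  \<open>C\<close> makes \<open>gr\<close> monotone on nonnegative arguments.\<close>

definition adm :: "ratfun fps \<Rightarrow> real \<Rightarrow> nat \<Rightarrow> nat \<Rightarrow> real \<Rightarrow> bool" where
  "adm y s M H C \<longleftrightarrow> C \<ge> 0 \<and> (\<forall>k. M < k \<longrightarrow> k < H \<longrightarrow> vle (fps_nth y k) (gr s C (real k - real M)))"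

text \<open>One \<open>C0\<close> must serve all \<open>H\<close> and \<open>C\<close>, otherwise
  the final choice of \<open>C\<close> would be circular. The level \<open>d\<close> counts factors
  divisible by x^M, and \<open>E * real h\<close> pays for the powers of \<open>qvar\<close> that
  dilates produce.\<close>

definition gr_filt :: "ratfun fps \<Rightarrow> real \<Rightarrow> real \<Rightarrow> nat \<Rightarrow> nat \<Rightarrow> (nat \<times> real \<Rightarrow> ratfun fps) \<Rightarrow> bool" where
  "gr_filt y s E M d f \<longleftrightarrow> (\<exists>C0\<ge>0. \<forall>H C. adm y s M H C \<longrightarrow>
     lowzero (d * M) (f (H, C)) \<and>
     (\<forall>h\<ge>d * M. vle (fps_nth (f (H, C)) h) (C0 + E * real h + gr s C (real h - real (d * M)))))"

lemma gr_filtI: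
  assumes "C0 \<ge> 0"
    "\<And>H C. adm y s M H C \<Longrightarrow> lowzero (d * M) (f (H, C))"
    "\<And>H C h. adm y s M H C \<Longrightarrow> h \<ge> d * M \<Longrightarrow>
       vle (fps_nth (f (H, C)) h) (C0 + E * real h + gr s C (real h - real (d * M)))"
  shows "gr_filt y s E M d f"
  unfolding gr_filt_def using assms by blast

lemma gr_filtE:
  assumes "gr_filt y s E M d f"
  obtains C0 where "C0 \<ge> 0"
    "\<And>H C. adm y s M H C \<Longrightarrow> lowzero (d * M) (f (H, C))"
    "\<And>H C h. adm y s M H C \<Longrightarrow> h \<ge> d * M \<Longrightarrow>
       vle (fps_nth (f (H, C)) h) (C0 + E * real h + gr s C (real h - real (d * M)))"
  using assms unfolding gr_filt_def by blast

text \<open>In a Cauchy product the shifts by multiples of \<open>M\<close> and the terms with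
  \<open>E\<close> add up exactly, superadditivity combines the two values of \<open>gr\<close>, and
  indices below a shift contribute nothing.\<close>

lemma series_filtration_gr_filt:
  assumes s: "s \<ge> 0"
  shows "series_filtration (gr_filt y s E M)"
proof
  fix c :: "ratfun fps" assume c: "fin_supp c"
  then obtain N where N: "\<And>h. h \<ge> N \<Longrightarrow> fps_nth c h = 0" by (auto simp: fin_supp_def)
  obtain C1 where C1: "C1 \<ge> 0" "\<And>h. vle (fps_nth c h) C1" using fin_supp_bound[OF c] by blast
  show "gr_filt y s E M 0 (\<lambda>_. c)"
  proof (rule gr_filtI)
    \<comment> \<open>\<open>E\<close> may be negative. Below index \<open>N\<close> the summand
      with \<open>\<bar>E\<bar>\<close> compensates \<open>E * real h\<close>; from \<open>N\<close>
      on the coefficients are zero.\<close>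
    show "0 \<le> C1 + \<bar>E\<bar> * real N" using C1 by simp
    fix H :: nat and C :: real and h :: nat
    assume "adm y s M H C"
    then have "0 \<le> gr s C (real h)" using s by (auto simp: adm_def intro: gr_nonneg)
    show "vle (fps_nth c h) (C1 + \<bar>E\<bar> * real N + E * real h + gr s C (real h - real (0 * M)))"
    proof (cases "h < N")
      case True
      have "- E * real h \<le> \<bar>E\<bar> * real N" using True by (intro mult_mono) auto
      then show ?thesis using \<open>0 \<le> gr s C (real h)\<close> by (intro vle_mono[OF C1(2)]) auto
    qed (simp add: N)
  qed auto
next
  fix d show "gr_filt y s E M d (\<lambda>_. 0)" by (rule gr_filtI[of 0]) auto
next
  fix d f g assume f: "gr_filt y s E M d f" and g: "gr_filt y s E M d g"
  obtain C1 where C1: "C1 \<ge> 0" "\<And>H C. adm y s M H C \<Longrightarrow> lowzero (d * M) (f (H, C))"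
    "\<And>H C h. adm y s M H C \<Longrightarrow> h \<ge> d * M \<Longrightarrow>
       vle (fps_nth (f (H, C)) h) (C1 + E * real h + gr s C (real h - real (d * M)))"
    using gr_filtE[OF f] by blast
  obtain C2 where C2: "C2 \<ge> 0" "\<And>H C. adm y s M H C \<Longrightarrow> lowzero (d * M) (g (H, C))"
    "\<And>H C h. adm y s M H C \<Longrightarrow> h \<ge> d * M \<Longrightarrow>
       vle (fps_nth (g (H, C)) h) (C2 + E * real h + gr s C (real h - real (d * M)))"
    using gr_filtE[OF g] by blast
  show "gr_filt y s E M d (\<lambda>\<iota>. f \<iota> + g \<iota>)"
  proof (rule gr_filtI)
    show "0 \<le> C1 + C2" using C1 C2 by simp
    fix H :: nat and C :: real and h :: nat
    assume a: "adm y s M H C"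
    then show "lowzero (d * M) (f (H, C) + g (H, C))" using C1(2) C2(2) by (intro lowzero_add)
    assume h: "d * M \<le> h"
    show "vle (fps_nth (f (H, C) + g (H, C)) h) (C1 + C2 + E * real h + gr s C (real h - real (d * M)))"
      unfolding fps_add_nth
      using C1(1) C2(1) by (intro vle_add; intro vle_mono[OF C1(3)[OF a h]] vle_mono[OF C2(3)[OF a h]]) auto
  qed
next
  fix d e f g assume f: "gr_filt y s E M d f" and g: "gr_filt y s E M e g"
  obtain C1 where C1: "C1 \<ge> 0" "\<And>H C. adm y s M H C \<Longrightarrow> lowzero (d * M) (f (H, C))"
    "\<And>H C h. adm y s M H C \<Longrightarrow> h \<ge> d * M \<Longrightarrow>
       vle (fps_nth (f (H, C)) h) (C1 + E * real h + gr s C (real h - real (d * M)))"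
    using gr_filtE[OF f] by blast
  obtain C2 where C2: "C2 \<ge> 0" "\<And>H C. adm y s M H C \<Longrightarrow> lowzero (e * M) (g (H, C))"
    "\<And>H C h. adm y s M H C \<Longrightarrow> h \<ge> e * M \<Longrightarrow>
       vle (fps_nth (g (H, C)) h) (C2 + E * real h + gr s C (real h - real (e * M)))"
    using gr_filtE[OF g] by blast
  show "gr_filt y s E M (d + e) (\<lambda>\<iota>. f \<iota> * g \<iota>)"
  proof (rule gr_filtI)
    show "0 \<le> C1 + C2" using C1 C2 by simp
    fix H :: nat and C :: real and h :: nat
    assume a: "adm y s M H C"
    show "lowzero ((d + e) * M) (f (H, C) * g (H, C))"
      using lowzero_mult[OF C1(2)[OF a] C2(2)[OF a]] by (simp add: distrib_right)
    assume h: "(d + e) * M \<le> h"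
    show "vle (fps_nth (f (H, C) * g (H, C)) h) (C1 + C2 + E * real h + gr s C (real h - real ((d + e) * M)))"
      unfolding fps_mult_nth
    proof (rule vle_sum)
      fix i assume i: "i \<in> {0..h}"
      show "vle (fps_nth (f (H, C)) i * fps_nth (g (H, C)) (h - i))
          (C1 + C2 + E * real h + gr s C (real h - real ((d + e) * M)))"
      proof (cases "d * M \<le> i \<and> e * M \<le> h - i")
        case True
        have "gr s C (real i - real (d * M)) + gr s C (real (h - i) - real (e * M))
            \<le> gr s C (real i - real (d * M) + (real (h - i) - real (e * M)))"
          using True s by (intro gr_superadditive) (auto simp flip: of_nat_mult)
        moreover have "real i - real (d * M) + (real (h - i) - real (e * M)) = real h - real ((d + e) * M)"
          using i by (simp add: algebra_simps of_nat_diff)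
        moreover have "E * real i + E * real (h - i) = E * real h"
          using i by (simp add: algebra_simps of_nat_diff)
        ultimately show ?thesis
          using True by (intro vle_mono[OF vle_mult[OF C1(3)[OF a] C2(3)[OF a]]]) auto
      next
        case False
        then have "fps_nth (f (H, C)) i * fps_nth (g (H, C)) (h - i) = 0"
          using C1(2)[OF a] C2(2)[OF a] by (auto simp: lowzero_def not_le)
        then show ?thesis by (simp only: vle_0)
      qed
    qed
  qed
next
  fix d f assume f: "gr_filt y s E M (Suc d) f"
  obtain C1 where C1: "C1 \<ge> 0" "\<And>H C. adm y s M H C \<Longrightarrow> lowzero (Suc d * M) (f (H, C))"
    "\<And>H C h. adm y s M H C \<Longrightarrow> h \<ge> Suc d * M \<Longrightarrow>
       vle (fps_nth (f (H, C)) h) (C1 + E * real h + gr s C (real h - real (Suc d * M)))"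
    using gr_filtE[OF f] by blast
  show "gr_filt y s E M d f"
  proof (rule gr_filtI[OF C1(1)])
    fix H :: nat and C :: real and h :: nat
    assume a: "adm y s M H C"
    show "lowzero (d * M) (f (H, C))" by (rule lowzero_mono[OF C1(2)[OF a]]) simp
    show "vle (fps_nth (f (H, C)) h) (C1 + E * real h + gr s C (real h - real (d * M)))"
    proof (cases "Suc d * M \<le> h")
      case True
      have "gr s C (real h - real (Suc d * M)) \<le> gr s C (real h - real (d * M))"
        using True a s by (intro gr_mono) (auto simp: adm_def simp flip: of_nat_mult of_nat_add)
      then show ?thesis by (intro vle_mono[OF C1(3)[OF a True]]) auto
    next
      case False
      then show ?thesis using C1(2)[OF a] by (simp add: lowzero_def not_le)
    qed
  qed
qed

end

section \<open>The recursion for the coefficients and the growth estimate\<close>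

lemma fps_mult_nth_low:
  assumes "lowzero l f" "lowzero H g"
  shows "fps_nth (f * g) (H + l) = fps_nth f l * fps_nth g H"
proof -
  have "fps_nth (f * g) (H + l) = (\<Sum>i\<in>{0..H+l}. if i = l then fps_nth f l * fps_nth g H else 0)"
    unfolding fps_mult_nth
  proof (rule sum.cong[OF refl])
    fix i assume i: "i \<in> {0..H+l}"
    consider "i < l" | "i = l" | "i > l" by linarith
    then show "fps_nth f i * fps_nth g (H + l - i) = (if i = l then fps_nth f l * fps_nth g H else 0)"
      using assms i by cases (auto simp: lowzero_def)
  qed
  then show ?thesis by simp
qed

text \<open>The expansion is taken at the solution, with increment \<open>fps_cutoff H y - y\<close>
  divisible by x^H. The remainder starts at x^(2H), beyond \<open>H + l\<close> because
  \<open>l < H\<close>, and in each linear term only the lowest coefficients of both factors meet.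
  The sign comes from the increment, whose coefficient at \<open>H\<close> is
  \<open>- fps_nth y H\<close>.\<close>

lemma polyop_cutoff_coefficient:
  assumes "polyop J \<Phi> d\<Phi>" "finite J" "\<Phi> y = 0"
    and low: "\<And>i. i \<in> J \<Longrightarrow> lowzero l (d\<Phi> i y)" and "l < H"
  shows "fps_nth (\<Phi> (fps_cutoff H y)) (H + l)
    = - ((\<Sum>i\<in>J. fps_nth (d\<Phi> i y) l * qvar ^ (i * H)) * fps_nth y H)"
proof -
  let ?z = "fps_cutoff H y - y"
  have z: "lowzero H ?z" by (rule lowzero_cutoff)
  have "fps_nth (\<Phi> (y + ?z) - \<Phi> y - (\<Sum>k\<in>J. d\<Phi> k y * dilate k ?z)) (H + l) = 0"
    using polyop_taylor_lowzero[OF assms(1,2) z, of y] assms(5) by (auto simp: lowzero_def)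
  then have "fps_nth (\<Phi> (fps_cutoff H y)) (H + l) = (\<Sum>k\<in>J. fps_nth (d\<Phi> k y * dilate k ?z) (H + l))"
    using assms(3) by (simp add: fps_sum_nth)
  also have "\<dots> = (\<Sum>k\<in>J. fps_nth (d\<Phi> k y) l * fps_nth (dilate k ?z) H)"
    by (intro sum.cong refl fps_mult_nth_low low) (auto simp: lowzero_def)
  also have "\<dots> = - ((\<Sum>i\<in>J. fps_nth (d\<Phi> i y) l * qvar ^ (i * H)) * fps_nth y H)"
    by (simp add: sum_distrib_right sum_negf mult.assoc)
  finally show ?thesis .
qed

context q_valuation
begin

text \<open>Here \<open>x\<close> is k - M for an earlier index k, and \<open>t\<close> is the
  distance from k to the current index. Expanding the square in \<open>gr s C (x + t)\<close> yields
  \<open>s * t * x\<close>, which pays for the stronger dilate up to \<open>s * t * M\<close>; this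
  and the constants fit into \<open>C * t\<close> because \<open>t \<ge> 1\<close>.\<close>

lemma linear_term_estimate:
  fixes x t :: real
  assumes "x \<ge> 0" "t \<ge> 1" "s \<ge> 0" "M \<ge> 0" "ei - ej \<le> s * t"
    and C: "C \<ge> s * M + \<bar>ej\<bar> + \<bar>C1 - D\<bar>"
  shows "C1 + (ei * (x + M) + gr s C x) \<le> ej * (x + M + t) + D + gr s C (x + t)"
proof -
  have "(ei - ej) * (x + M) \<le> s * t * (x + M)" using assms by (intro mult_right_mono) auto
  moreover have "\<bar>C1 - D\<bar> * 1 \<le> \<bar>C1 - D\<bar> * t" using assms by (intro mult_left_mono) auto
  moreover have "- ej * t \<le> \<bar>ej\<bar> * t" using assms by (intro mult_right_mono) auto
  moreover have "(s * M + \<bar>ej\<bar> + \<bar>C1 - D\<bar>) * t \<le> C * t" using assms by (intro mult_right_mono) auto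
  moreover have "0 \<le> s * t\<^sup>2" using assms by simp
  moreover have "gr s C (x + t) = gr s C x + s * t * x + s * t\<^sup>2 / 2 + C * t"
    by (simp add: gr_def power2_eq_square field_simps)
  ultimately show ?thesis by (simp add: algebra_simps)
qed

text \<open>Here \<open>K\<close> is H - M and \<open>g\<close> is M - l: a term of level 2 at index
  H + l has argument H + l - 2M = \<open>K - g\<close>. Of the quadratic saving only
  \<open>s * g * K / 2\<close> is spent, whence the factor 2 in the assumption on
  \<open>E - ej\<close>; the constants are absorbed by \<open>C * g\<close>.\<close>

lemma nonlinear_term_estimate:
  fixes g K :: real
  assumes "g \<ge> 1" "K \<ge> g" "s \<ge> 0" "M \<ge> 0" "ej \<le> E" "2 * (E - ej) \<le> s * g"
    and C: "C \<ge> \<bar>C2 + E * l - D\<bar> + (E - ej) * M"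
  shows "C2 + E * (K + M + l) + gr s C (K - g) \<le> ej * (K + M) + D + gr s C K"
proof -
  define u v w where "u = (E - ej) * K" and "v = (E - ej) * M" and "w = s * g * K"
  have "2 * (E - ej) * K \<le> s * g * K" using assms by (intro mult_right_mono) auto
  then have "2 * u \<le> w" by (simp only: u_def w_def mult.assoc)
  moreover have "0 \<le> v" using assms by (simp add: v_def)
  with C have "C \<ge> 0" by (simp add: v_def)
  then have "C * 1 \<le> C * g" using assms by (intro mult_left_mono) auto
  moreover have "0 \<le> s * g * (K - g)" using assms by simp
  moreover have "gr s C (K - g) = gr s C K - w / 2 - s * g * (K - g) / 2 - C * g"
    by (simp add: gr_def w_def power2_eq_square field_simps)
  moreover have "E * (K + M + l) = u + v + E * l + ej * (K + M)"
    by (simp add: u_def v_def algebra_simps)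
  moreover have "C \<ge> C2 + E * l - D + v" using C by (simp add: v_def)
  ultimately show ?thesis by linarith
qed

text \<open>\<open>slope\<close> places every monomial of the linear part above the side that starts
  at \<open>(j, l)\<close>. For \<open>s = 0\<close> no choice of \<open>M\<close> saves anything,
  so \<open>s0\<close> must exclude stronger dilates altogether, also those whose linear coefficient
  vanishes along \<open>y\<close>.\<close>

theorem coefficient_growth:
  assumes pop: "polyop J \<Phi> d\<Phi>" and fin: "finite J" and sol: "\<Phi> y = 0"
    and j: "j \<in> J" and eps: "\<epsilon> \<noteq> 0"
    and low: "\<And>i. i \<in> J \<Longrightarrow> lowzero l (d\<Phi> i y)"
    and lead: "fps_nth (d\<Phi> j y) l \<noteq> 0"
    and slope: "\<And>i t. i \<in> J \<Longrightarrow> fps_nth (d\<Phi> i y) (l + t) \<noteq> 0 \<Longrightarrow> \<epsilon> * real i - \<epsilon> * real j \<le> s * real t"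
    and s: "s \<ge> 0" and s0: "s = 0 \<Longrightarrow> \<forall>i\<in>J. \<epsilon> * real i \<le> \<epsilon> * real j"
  shows "\<exists>C. eventually (\<lambda>h. vle (fps_nth y h) (s * (real h)\<^sup>2 / 2 + C * real h)) sequentially"
proof -
  define e where "e i = \<epsilon> * real i" for i
  define E where "E = Max (e ` J)"
  have E: "e i \<le> E" if "i \<in> J" for i
    unfolding E_def using fin that by auto
  have "E \<in> e ` J" unfolding E_def using fin j by (intro Max_in) auto
  then have E0: "E = e j" if "s = 0" using s0[OF that] E[OF j] by (auto simp: e_def)
  \<comment> \<open>The inequality makes the saving outweigh the strongest dilate, both in nonlinear
    terms and in linear terms whose coefficient has index above \<open>M\<close>. For
    \<open>s = 0\<close> both of its sides are zero.\<close>
  obtain M where M: "l < M" "2 * (E - e j) \<le> s * (real M - real l)"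
  proof (cases "s = 0")
    case True
    then show ?thesis using that[of "Suc l"] E0 by simp
  next
    case False
    then obtain n where n: "2 * (E - e j) < real n * s"
      using s reals_Archimedean3[of s] by auto
    then have "2 * (E - e j) \<le> s * (real (Suc n + l) - real l)"
      using s by (simp add: algebra_simps)
    then show ?thesis using that[of "Suc n + l"] by simp
  qed
  define p where "p = fps_cutoff (Suc M) y"
  have fp: "fin_supp p" by (simp add: p_def)
  note pfs = polyop_fin_supp[OF pop fp]
  obtain N1 where N1: "\<And>h. h \<ge> N1 \<Longrightarrow> fps_nth (\<Phi> p) h = 0"
    using pfs by (auto simp: fin_supp_def)
  have "\<forall>i. \<exists>c\<ge>0. \<forall>h. vle (fps_nth (d\<Phi> i p) h) c"
    using pfs fin_supp_bound by metis
  then obtain c where c: "\<And>i. c i \<ge> 0" "\<And>i h. vle (fps_nth (d\<Phi> i p) h) (c i)" by metis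
  define C1 where "C1 = sum c J"
  have C1: "vle (fps_nth (d\<Phi> i p) h) C1" if "i \<in> J" for i h
    using member_le_sum[of i J c] that c fin unfolding C1_def by (intro vle_mono[OF c(2)]) auto
  have pd: "fps_nth (d\<Phi> i p) a = fps_nth (d\<Phi> i y) a" if "a \<le> M" for i a
  proof -
    have "lowzero (Suc M) (d\<Phi> i p - d\<Phi> i y)"
      using polyop_cong_low[OF pop, of "Suc M" p y] lowzero_cutoff[of "Suc M" y] by (auto simp: p_def)
    then show ?thesis using that by (auto simp: lowzero_def)
  qed

  interpret series_filtration "gr_filt y s E M" by (rule series_filtration_gr_filt[OF s])
  \<comment> \<open>The tail of the truncation above \<open>M\<close>; its index carries
    \<open>C\<close> beside \<open>H\<close> because the admissible bounds depend on it.\<close>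
  define Z where "Z = (\<lambda>\<iota>::nat \<times> real. fps_cutoff (fst \<iota>) (y - p))"
  have Z: "fps_nth (Z (H, C)) k = (if M < k \<and> k < H then fps_nth y k else 0)" for H C k
    by (auto simp: Z_def p_def)
  have B1: "gr_filt y s E M 1 (\<lambda>\<iota>. dilate i (Z \<iota>))" if i: "i \<in> J" for i
  proof (rule gr_filtI[of 0])
    fix H :: nat and C :: real and h :: nat
    assume a: "adm y s M H C"
    show "lowzero (1 * M) (dilate i (Z (H, C)))" by (simp add: lowzero_def Z)
    show "vle (fps_nth (dilate i (Z (H, C))) h) (0 + E * real h + gr s C (real h - real (1 * M)))"
    proof (cases "M < h \<and> h < H")
      case True
      then have "vle (fps_nth y h) (gr s C (real h - real M))" using a by (auto simp: adm_def)
      from vle_q_power_mult[OF this, of "i * h"] show ?thesis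
        using True mult_right_mono[OF E[OF i], of "real h"]
        by (auto simp: Z e_def algebra_simps intro: vle_mono)
    qed (auto simp: Z)
  qed simp
  define R where "R = (\<lambda>\<iota>. \<Phi> (p + Z \<iota>) - \<Phi> p - (\<Sum>k\<in>J. d\<Phi> k p * dilate k (Z \<iota>)))"
  have "gr_filt y s E M 2 R"
    unfolding R_def using polyop_taylor[OF pop fin, of "\<lambda>_. p" Z] B1 fp fin_supp_dilate B_const by blast
  then obtain C2 where C2: "C2 \<ge> 0" "\<And>H C. adm y s M H C \<Longrightarrow> lowzero (2 * M) (R (H, C))"
    "\<And>H C h. adm y s M H C \<Longrightarrow> h \<ge> 2 * M \<Longrightarrow>
       vle (fps_nth (R (H, C)) h) (C2 + E * real h + gr s C (real h - real (2 * M)))"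
    using gr_filtE by blast

  define D where "D = \<delta> (fps_nth (d\<Phi> j y) l)"
  define P where "P h = (\<Sum>i\<in>J. fps_nth (d\<Phi> i y) l * qvar ^ (i * h))" for h
  \<comment> \<open>At \<open>t = 0\<close> the slope condition gives the weak inequality on the
    bottom side; \<open>\<epsilon> \<noteq> 0\<close> and \<open>i \<noteq> j\<close> make it
    strict.\<close>
  have "\<epsilon> * real i < \<epsilon> * real j" if "i \<in> J" "i \<noteq> j" "fps_nth (d\<Phi> i y) l \<noteq> 0" for i
    using slope[of i 0] that eps by (auto simp: less_le)
  note val_leading_sum[OF fin j, of "\<lambda>i. fps_nth (d\<Phi> i y) l", OF lead this]
  then obtain H2
    where H2: "\<And>h. h \<ge> H2 \<Longrightarrow> P h \<noteq> 0 \<and> e j * real h + D \<le> \<delta> (P h)"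
    unfolding eventually_sequentially P_def D_def e_def by blast
  \<comment> \<open>From \<open>H1\<close> on the fixed part contributes nothing, \<open>P\<close>
    is governed by its extremal term, and the recursion applies. Earlier coefficients are covered by
    the first summand of \<open>C\<close>; its other summands are those demanded by the linear and
    the nonlinear estimate.\<close>
  define H1 where "H1 = max N1 (max H2 (Suc M))"
  define C where "C = (\<Sum>k<H1. \<bar>\<delta> (fps_nth y k)\<bar>) + (s * real M + \<bar>e j\<bar> + \<bar>C1 - D\<bar>)
    + (\<bar>C2 + E * real l - D\<bar> + (E - e j) * real M)"
  have nonneg: "(\<Sum>k<H1. \<bar>\<delta> (fps_nth y k)\<bar>) \<ge> 0" "s * real M \<ge> 0" "(E - e j) * real M \<ge> 0"
    using s E[OF j] by (auto intro: sum_nonneg)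
  have C: "C \<ge> 0" "C \<ge> (\<Sum>k<H1. \<bar>\<delta> (fps_nth y k)\<bar>)" "C \<ge> s * real M + \<bar>e j\<bar> + \<bar>C1 - D\<bar>"
    "C \<ge> \<bar>C2 + E * real l - D\<bar> + (E - e j) * real M"
    using nonneg by (simp_all add: C_def)

  have bound: "vle (fps_nth y h) (gr s C (real h - real M))" if "M < h" for h
    using that
  proof (induction h rule: less_induct)
    case (less H)
    \<comment> \<open>As \<open>H\<close> exceeds \<open>M\<close>, the argument of
      \<open>gr\<close> is at least 1, so the linear term alone dominates the initial
      coefficients.\<close>
    have gC: "gr s C (real H - real M) \<ge> C"
    proof -
      have "C * 1 \<le> C * (real H - real M)" using less.prems C(1) by (intro mult_left_mono) auto
      then show ?thesis using s by (simp add: gr_def add_increasing)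
    qed
    show ?case
    proof (cases "H < H1")
      case True
      then have "\<bar>\<delta> (fps_nth y H)\<bar> \<le> (\<Sum>k<H1. \<bar>\<delta> (fps_nth y k)\<bar>)"
        by (intro member_le_sum) auto
      then have "\<delta> (fps_nth y H) \<le> C" using C(2) by linarith
      then show ?thesis using gC by (simp add: vle_def)
    next
      case False
      let ?b = "e j * real H + D + gr s C (real H - real M)"
      have H: "H \<ge> N1" "H \<ge> H2" "H > M" using False by (auto simp: H1_def)
      have a: "adm y s M H C" using less.IH C(1) by (auto simp: adm_def)
      have cutH: "fps_cutoff H y = p + Z (H, C)"
        using H by (intro fps_ext) (auto simp: p_def Z)
      have lin: "vle (fps_nth (d\<Phi> i p * dilate i (Z (H, C))) (H + l)) ?b" if i: "i \<in> J" for i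
        unfolding fps_mult_nth
      proof (rule vle_sum)
        fix b assume b: "b \<in> {0..H+l}"
        let ?k = "H + l - b"
        show "vle (fps_nth (d\<Phi> i p) b * fps_nth (dilate i (Z (H, C))) ?k) ?b"
        proof (cases "M < ?k \<and> ?k < H \<and> fps_nth (d\<Phi> i p) b \<noteq> 0")
          case True
          define t where "t = H - ?k"
          have t: "b = l + t" "t \<ge> 1" "real H = real ?k + real t"
            using True b by (auto simp: t_def)
          have et: "e i - e j \<le> s * real t"
          proof (cases "b \<le> M")
            case True
            then show ?thesis
              using slope[OF i, of t] t(1) pd[of b i] \<open>_ \<and> _ \<and> fps_nth (d\<Phi> i p) b \<noteq> 0\<close> by (auto simp: e_def)
          next
            case False
            have "e i - e j \<le> E - e j" using E[OF i] by simp
            also have "\<dots> \<le> 2 * (E - e j)" using E[OF j] by simp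
            also have "\<dots> \<le> s * (real M - real l)" by (rule M(2))
            also have "\<dots> \<le> s * real t" using False t s by (intro mult_left_mono) auto
            finally show ?thesis .
          qed
          have "vle (fps_nth y ?k) (gr s C (real ?k - real M))" using less.IH True by blast
          from vle_q_power_mult[OF this, of "i * ?k"]
          have "vle (fps_nth (dilate i (Z (H, C))) ?k) (e i * real ?k + gr s C (real ?k - real M))"
            using True by (simp add: Z e_def mult.assoc)
          from vle_mult[OF C1[OF i] this, of b] show ?thesis
          proof (rule vle_mono)
            show "C1 + (e i * real ?k + gr s C (real ?k - real M)) \<le> ?b"
            proof -
              have "C1 + (e i * (real ?k - real M + real M) + gr s C (real ?k - real M))
                  \<le> e j * (real ?k - real M + real M + real t) + D + gr s C (real ?k - real M + real t)"
              proof (rule linear_term_estimate[OF _ _ s _ et C(3)])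
                show "0 \<le> real ?k - real M" using True by linarith
                show "1 \<le> real t" using t(2) by simp
              qed simp
              moreover have "real ?k - real M + real M + real t = real H"
                "real ?k - real M + real t = real H - real M" "real ?k - real M + real M = real ?k"
                using t(3) by simp_all
              ultimately show ?thesis by (simp only:)
            qed
          qed
        qed (auto simp: Z)
      qed
      have nonlin: "vle (fps_nth (R (H, C)) (H + l)) ?b"
      proof (cases "H + l \<ge> 2 * M")
        case True
        have "C2 + E * (real H - real M + real M + real l) + gr s C (real H - real M - (real M - real l))
            \<le> e j * (real H - real M + real M) + D + gr s C (real H - real M)"
          using M s E[OF j] C(4) True by (intro nonlinear_term_estimate) auto
        moreover have "real H - real M - (real M - real l) = real (H + l) - real (2 * M)" by simp
        ultimately show ?thesis
          by (intro vle_mono[OF C2(3)[OF a True]]) simp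
      next
        case False
        then show ?thesis using C2(2)[OF a] by (simp add: lowzero_def)
      qed
      have "fps_nth (\<Phi> (fps_cutoff H y)) (H + l)
          = fps_nth (\<Phi> p + (\<Sum>k\<in>J. d\<Phi> k p * dilate k (Z (H, C))) + R (H, C)) (H + l)"
        unfolding cutH R_def by (simp add: algebra_simps)
      also have "\<dots> = (\<Sum>k\<in>J. fps_nth (d\<Phi> k p * dilate k (Z (H, C))) (H + l)) + fps_nth (R (H, C)) (H + l)"
        using N1[of "H + l"] H by (simp add: fps_sum_nth)
      finally have "vle (fps_nth (\<Phi> (fps_cutoff H y)) (H + l)) ?b"
        using lin nonlin by (auto intro!: vle_add vle_sum)
      moreover have "fps_nth (\<Phi> (fps_cutoff H y)) (H + l) = - (P H * fps_nth y H)"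
        unfolding P_def using pop fin sol low M H by (intro polyop_cutoff_coefficient) auto
      ultimately have "vle (P H * fps_nth y H) ?b" by simp
      then show ?thesis
        using H2[OF H(2)] val_mult[of "P H" "fps_nth y H"]
        by (cases "fps_nth y H = 0") (auto simp: vle_def)
    qed
  qed
  have "vle (fps_nth y h) (s * (real h)\<^sup>2 / 2 + C * real h)" if "h \<ge> Suc M" for h
  proof -
    have "gr s C (real h - real M) \<le> gr s C (real h)"
      using that s C(1) by (intro gr_mono) auto
    then show ?thesis using bound[of h] that by (auto simp: gr_def intro: vle_mono)
  qed
  then show ?thesis by (auto simp: eventually_sequentially)
qed

end

subsection \<open>Eliminating variables from the linearized operator\<close>

definition from_var :: "nat \<Rightarrow> nat \<Rightarrow> mpoly set" where
  "from_var n m = {F. vars F \<subseteq> {Var_q, Var_x} \<union> Var_w ` {m..n}}"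

lemma from_var_const [simp]: "Poly_Mapping.single 0 c \<in> from_var n m"
  by (simp add: from_var_def)

lemma from_var_0 [simp]: "0 \<in> from_var n m"
  by (simp add: from_var_def vars_def)

lemma from_var_of_nat [simp]: "of_nat k \<in> from_var n m"
  using from_var_const[of "of_nat k"] by simp

lemma from_var_add: "F \<in> from_var n m \<Longrightarrow> G \<in> from_var n m \<Longrightarrow> F + G \<in> from_var n m"
  using vars_add[of F G] by (auto simp: from_var_def)

lemma from_var_mult: "F \<in> from_var n m \<Longrightarrow> G \<in> from_var n m \<Longrightarrow> F * G \<in> from_var n m"
  using vars_mult[of F G] by (auto simp: from_var_def)

lemma from_var_diff: "F \<in> from_var n m \<Longrightarrow> G \<in> from_var n m \<Longrightarrow> F - G \<in> from_var n m"
  using vars_add[of F "- G"] by (auto simp: from_var_def)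

lemma from_var_sum: "(\<And>i. i \<in> A \<Longrightarrow> f i \<in> from_var n m) \<Longrightarrow> sum f A \<in> from_var n m"
  by (induction A rule: infinite_finite_induct) (auto intro: from_var_add)

text \<open>The library's \<open>pderiv\<close> is not available, since \<open>mpoly\<close> carries no integral domain instance.\<close>

definition dpoly :: "'a::comm_ring_1 poly \<Rightarrow> 'a poly" where
  "dpoly P = (\<Sum>k<degree P. monom (of_nat (Suc k) * coeff P (Suc k)) k)"

lemma coeff_dpoly: "coeff (dpoly P) k = of_nat (Suc k) * coeff P (Suc k)"
proof -
  have "coeff (dpoly P) k
      = (\<Sum>i<degree P. if i = k then of_nat (Suc i) * coeff P (Suc i) else 0)"
    unfolding dpoly_def coeff_sum by (intro sum.cong) auto
  then show ?thesis by (auto simp: coeff_eq_0)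
qed

lemma degree_dpoly: "degree P > 0 \<Longrightarrow> degree (dpoly P) < degree P"
  using degree_le[of "degree P - 1" "dpoly P"] by (fastforce simp: coeff_dpoly coeff_eq_0)

lemma dpoly_pCons: "dpoly (pCons a Q) = Q + pCons 0 (dpoly Q)"
  by (rule poly_eqI) (auto simp: coeff_dpoly coeff_pCons algebra_simps split: nat.split)

lemma dpoly_diff: "dpoly (P - Q) = dpoly P - dpoly Q"
  by (rule poly_eqI) (simp add: coeff_dpoly algebra_simps)

lemma dpoly_0 [simp]: "dpoly 0 = 0"
  by (simp add: dpoly_def)

lemma partial_deriv_poly:
  "partial_deriv v (poly P X) = poly (map_poly (partial_deriv v) P) X + poly (dpoly P) X * partial_deriv v X"
  by (induction P)
    (simp_all add: map_poly_pCons dpoly_pCons partial_deriv_add partial_deriv_mult algebra_simps)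

lemma eval_along_poly:
  "eval_along (poly P X) y = poly (map_poly (\<lambda>c. eval_along c y) P) (eval_along X y)"
  by (induction P) (simp_all add: map_poly_pCons eval_along_add eval_along_mult)

lemma eval_along_of_nat: "eval_along (of_nat k) y = of_nat k"
  by (induction k) (simp_all add: eval_along_add)

lemma of_nat_Suc_ratfun_fps: "of_nat (Suc k) \<noteq> (0 :: ratfun fps)"
proof -
  have "of_nat i = (Fract (of_nat i) 1 :: ratfun)" for i
    by (induction i) (simp_all add: Zero_fract_def One_fract_def)
  then have "(of_nat (Suc k) :: ratfun) \<noteq> 0"
    by (simp add: Zero_fract_def eq_fract del: of_nat_Suc)
  then show ?thesis by (metis fps_const_eq_0_iff fps_of_nat)
qed

lemma degree_lessI_coeff:
  assumes "d > 0" "\<And>k. k \<ge> d \<Longrightarrow> coeff P k = 0"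
  shows "degree P < d"
  using degree_le[of "d - 1" P] assms by force

lemma all_coeff_pCons: "(\<forall>k. coeff (pCons a P) k \<in> S) \<longleftrightarrow> a \<in> S \<and> (\<forall>k. coeff P k \<in> S)"
  by (auto simp: coeff_pCons split: nat.split)

lemma from_var_as_poly:
  assumes "F \<in> from_var n m"
  obtains P where "\<And>k. coeff P k \<in> from_var n (Suc m)" "F = poly P (mvar (Var_w m))"
proof -
  have "vars F \<subseteq> {Var_q, Var_x} \<union> Var_w ` {m..n}" using assms by (simp add: from_var_def)
  then have "\<exists>P. (\<forall>k. coeff P k \<in> from_var n (Suc m)) \<and> F = poly P (mvar (Var_w m))"
  proof (induction F rule: mpoly_ring_induct)
    case (const c)
    show ?case by (intro exI[of _ "[:Poly_Mapping.single 0 c:]"] conjI) (simp_all add: all_coeff_pCons)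
  next
    case (var v)
    show ?case
    proof (cases "v = Var_w m")
      case True
      have "1 \<in> from_var n (Suc m)" using from_var_const[of 1] by simp
      then show ?thesis using True
        by (intro exI[of _ "[:0, 1:]"] conjI) (simp_all add: all_coeff_pCons)
    next
      case False
      have "{m..n} \<subseteq> insert m {Suc m..n}" by auto
      then have "v \<in> {Var_q, Var_x} \<union> Var_w ` {Suc m..n}" using var False by blast
      then have "mvar v \<in> from_var n (Suc m)" by (simp add: from_var_def)
      then show ?thesis
        by (intro exI[of _ "[:mvar v:]"] conjI) (simp_all add: all_coeff_pCons)
    qed
  next
    case (add G H)
    then obtain P Q where "\<forall>k. coeff P k \<in> from_var n (Suc m)" "G = poly P (mvar (Var_w m))"
      "\<forall>k. coeff Q k \<in> from_var n (Suc m)" "H = poly Q (mvar (Var_w m))" by blast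
    then show ?case by (intro exI[of _ "P + Q"]) (simp add: from_var_add)
  next
    case (mult G H)
    then obtain P Q where "\<forall>k. coeff P k \<in> from_var n (Suc m)" "G = poly P (mvar (Var_w m))"
      "\<forall>k. coeff Q k \<in> from_var n (Suc m)" "H = poly Q (mvar (Var_w m))" by blast
    then show ?case
      by (intro exI[of _ "P * Q"]) (simp add: coeff_mult from_var_sum from_var_mult)
  qed
  then show ?thesis using that by blast
qed

lemma linearized_diff: "linearized (F - G) y i = linearized F y i - linearized G y i"
  using partial_deriv_add[of "Var_w i" "F - G" G] by (simp add: linearized_def eval_along_add)

lemma linearized_mult: "linearized (F * G) y i = linearized F y i * eval_along G y + eval_along F y * linearized G y i"
  by (simp add: linearized_def partial_deriv_mult eval_along_add eval_along_mult)

text \<open>The gradients along \<open>y\<close> of the polynomials in \<open>w\<^sub>m, \<dots>, w\<^sub>n\<close> that vanish along \<open>y\<close>, up to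
  linear combinations over \<open>C(q)((x))\<close>.\<close>

inductive conormal :: "nat \<Rightarrow> ratfun fps \<Rightarrow> nat \<Rightarrow> (nat \<Rightarrow> ratfun fps) \<Rightarrow> bool" for n y m where
  gradient: "F \<in> from_var n m \<Longrightarrow> eval_along F y = 0 \<Longrightarrow> conormal n y m (\<lambda>i. g * linearized F y i)"
| add: "conormal n y m a \<Longrightarrow> conormal n y m b \<Longrightarrow> conormal n y m (\<lambda>i. a i + b i)"
| div: "c \<noteq> 0 \<Longrightarrow> conormal n y m (\<lambda>i. c * a i) \<Longrightarrow> conormal n y m a"

lemma conormal_zero: "conormal n y m (\<lambda>i. 0)"
  using conormal.gradient[of 0 n m y 0] by simp

lemma conormal_scale: "conormal n y m a \<Longrightarrow> conormal n y m (\<lambda>i. g * a i)"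
proof (induction rule: conormal.induct)
  case (gradient F h)
  then show ?case using conormal.gradient[of F n m y "g * h"] by (simp add: mult.assoc)
next
  case (add a b)
  then show ?case using conormal.add by (simp add: distrib_left)
next
  case (div c a)
  then show ?case using conormal.div[of c n y m "\<lambda>i. g * a i"] by (simp add: mult.left_commute)
qed

lemma conormal_below: "conormal n y m b \<Longrightarrow> i < m \<Longrightarrow> b i = 0"
proof (induction rule: conormal.induct)
  case (gradient F g)
  then have "Var_w i \<notin> vars F" by (auto simp: from_var_def)
  then show ?case by (simp add: linearized_def partial_deriv_not_in_vars)
qed auto

section \<open>Eliminating a single variable\<close>

context
  fixes n m :: nat and y :: "ratfun fps"
begin

abbreviation wm :: mpoly where "wm \<equiv> mvar (Var_w m)"

definition cpolys :: "mpoly poly set" where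
  "cpolys = {P. \<forall>k. coeff P k \<in> from_var n (Suc m)}"

definition epoly :: "mpoly poly \<Rightarrow> ratfun fps" where
  "epoly P = eval_along (poly P wm) y"

lemma epoly_coeffs_0: "(\<And>k. eval_along (coeff P k) y = 0) \<Longrightarrow> epoly P = 0"
proof -
  assume "\<And>k. eval_along (coeff P k) y = 0"
  then have "map_poly (\<lambda>c. eval_along c y) P = 0" by (intro poly_eqI) (simp add: coeff_map_poly)
  then show ?thesis by (simp add: epoly_def eval_along_poly)
qed

lemma dpoly_cpolys: "P \<in> cpolys \<Longrightarrow> dpoly P \<in> cpolys"
  unfolding cpolys_def mem_Collect_eq coeff_dpoly by (blast intro: from_var_mult from_var_of_nat)

text \<open>In characteristic \<open>0\<close> a polynomial all of whose derivatives vanish at a point is zero.\<close>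

lemma coeffs_vanish:
  assumes closed: "\<And>Q. Q \<in> cpolys \<Longrightarrow> degree Q \<le> N \<Longrightarrow> epoly Q = 0 \<Longrightarrow> epoly (dpoly Q) = 0"
    and "P \<in> cpolys" "degree P \<le> N" "epoly P = 0"
  shows "eval_along (coeff P k) y = 0"
  using assms(2-)
proof (induction "degree P" arbitrary: P k rule: less_induct)
  case less
  \<comment> \<open>The derivative has smaller degree, and its coefficients are those of
    \<open>P\<close> times nonzero integers. Once the higher coefficients vanish along
    \<open>y\<close>, the value of \<open>P\<close> is its constant coefficient.\<close>
  have S: "eval_along (coeff P (Suc k)) y = 0" for k
  proof (cases "degree P = 0")
    case False
    then have "degree (dpoly P) < degree P" by (intro degree_dpoly) auto
    moreover have "epoly (dpoly P) = 0" using less.prems by (intro closed)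
    ultimately have "eval_along (coeff (dpoly P) k) y = 0"
      using less.prems by (intro less.hyps) (auto intro: dpoly_cpolys)
    then show ?thesis
      using of_nat_Suc_ratfun_fps[of k]
      by (simp add: coeff_dpoly eval_along_mult eval_along_of_nat del: of_nat_Suc)
  qed (simp add: coeff_eq_0)
  have "map_poly (\<lambda>c. eval_along c y) P = [:eval_along (coeff P 0) y:]"
    by (rule poly_eqI) (auto simp: coeff_map_poly coeff_pCons S split: nat.split)
  then have "eval_along (coeff P 0) y = 0"
    using less.prems by (simp add: epoly_def eval_along_poly)
  then show ?case using S by (cases k) auto
qed

text \<open>Each coefficient is itself a polynomial without the variable of index \<open>m\<close>
  that vanishes along \<open>y\<close>; the sum of its differentiated coefficients is thus a
  combination of admissible gradients, collected by Horner's scheme.\<close>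

lemma conormal_map_poly:
  assumes "P \<in> cpolys" "\<And>k. eval_along (coeff P k) y = 0"
  shows "conormal n y (Suc m) (\<lambda>i. epoly (map_poly (partial_deriv (Var_w i)) P))"
  using assms
proof (induction P)
  case 0
  then show ?case by (simp add: epoly_def conormal_zero)
next
  case (pCons a Q)
  have Q: "Q \<in> cpolys" "\<And>k. eval_along (coeff Q k) y = 0"
    using pCons.prems(1) pCons.prems(2)[of "Suc _"] unfolding cpolys_def
    by (auto simp: coeff_pCons dest: spec[of _ "Suc _"])
  have a: "a \<in> from_var n (Suc m)" "eval_along a y = 0"
    using pCons.prems(1) pCons.prems(2)[of 0] unfolding cpolys_def by (auto dest: spec[of _ 0])
  have "conormal n y (Suc m) (\<lambda>i. 1 * linearized a y i
      + eval_along wm y * epoly (map_poly (partial_deriv (Var_w i)) Q))"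
    using pCons.IH[OF Q] a by (intro conormal.add conormal.gradient conormal_scale)
  then show ?case
    by (simp add: map_poly_pCons epoly_def linearized_def eval_along_add eval_along_mult)
qed

lemma linearized_poly:
  "linearized (poly P wm) y i = epoly (map_poly (partial_deriv (Var_w i)) P)
     + (if i = m then epoly (dpoly P) else 0)"
  by (auto simp: linearized_def partial_deriv_poly epoly_def eval_along_add eval_along_mult partial_deriv_mvar)

lemma conormal_linearized_poly:
  assumes "P \<in> cpolys" "\<And>k. eval_along (coeff P k) y = 0"
  shows "conormal n y (Suc m) (linearized (poly P wm) y)"
proof -
  have "eval_along (coeff (dpoly P) k) y = 0" for k
    using assms(2) by (simp add: coeff_dpoly eval_along_mult)
  then have "epoly (dpoly P) = 0" by (rule epoly_coeffs_0)
  then have "linearized (poly P wm) y = (\<lambda>i. epoly (map_poly (partial_deriv (Var_w i)) P))"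
    by (auto simp: linearized_poly fun_eq_iff)
  then show ?thesis using conormal_map_poly[OF assms] by simp
qed

text \<open>Over the fraction field: \<open>a\<close> is a multiple of \<open>u\<close> modulo the
  conormal vectors of level \<open>Suc m\<close>. Denominators are cleared by \<open>\<mu>\<close>,
  since all entries are power series.\<close>

definition modulo_gradient :: "(nat \<Rightarrow> ratfun fps) \<Rightarrow> (nat \<Rightarrow> ratfun fps) \<Rightarrow> bool" where
  "modulo_gradient u a \<longleftrightarrow> (\<exists>\<mu> \<nu> b. \<mu> \<noteq> 0 \<and> conormal n y (Suc m) b \<and> (\<forall>i. \<mu> * a i = \<nu> * u i + b i))"

text \<open>Pseudo-division by a polynomial \<open>Q\<close> of minimal degree in \<open>w\<^sub>m\<close> that vanishes along \<open>y\<close> while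
  its derivative with respect to \<open>w\<^sub>m\<close> does not; if there is none, all gradients already come from
  polynomials without \<open>w\<^sub>m\<close>.\<close>

lemma gradients_modulo:
  obtains u where "u m = 0 \<Longrightarrow> u = (\<lambda>_. 0)"
    "\<And>P. P \<in> cpolys \<Longrightarrow> epoly P = 0 \<Longrightarrow> modulo_gradient u (linearized (poly P wm) y)"
proof (cases "\<forall>P\<in>cpolys. epoly P = 0 \<longrightarrow> epoly (dpoly P) = 0")
  case True
  have "modulo_gradient (\<lambda>_. 0) (linearized (poly P wm) y)" if P: "P \<in> cpolys" "epoly P = 0" for P
  proof -
    have "eval_along (coeff P k) y = 0" for k
      using P True by (intro coeffs_vanish[of "degree P"]) auto
    from conormal_linearized_poly[OF P(1) this] show ?thesis
      unfolding modulo_gradient_def by (intro exI[of _ 1]) auto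
  qed
  then show ?thesis using that[of "\<lambda>_. 0"] by simp
next
  case False
  define good where "good P \<longleftrightarrow> P \<in> cpolys \<and> epoly P = 0 \<and> epoly (dpoly P) \<noteq> 0" for P
  obtain P0 where "good P0" using False by (auto simp: good_def)
  from exists_least_iff[of "\<lambda>d. \<exists>P. good P \<and> degree P = d"] this
  obtain Q where Q: "good Q" "\<And>P. good P \<Longrightarrow> degree Q \<le> degree P"
    by (metis linorder_not_less)
  define d where "d = degree Q"
  define c where "c = coeff Q d"
  have QC: "Q \<in> cpolys" "epoly Q = 0" "epoly (dpoly Q) \<noteq> 0" using Q(1) by (auto simp: good_def)
  have d: "d > 0"
  proof (rule ccontr)
    assume "\<not> d > 0"
    then have "dpoly Q = 0" by (simp add: dpoly_def d_def)
    then show False using QC(3) by (simp add: epoly_def)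
  qed
  \<comment> \<open>Were the leading coefficient zero along \<open>y\<close>, dropping the leading
    term would change neither value nor derivative along \<open>y\<close>, contradicting
    minimality.\<close>
  have c: "eval_along c y \<noteq> 0"
  proof
    assume c0: "eval_along c y = 0"
    have "eval_along (coeff (monom c d) k) y = 0" "eval_along (coeff (dpoly (monom c d)) k) y = 0" for k
      using c0 by (simp_all add: coeff_dpoly eval_along_mult)
    then have m: "epoly (monom c d) = 0" "epoly (dpoly (monom c d)) = 0"
      by (auto intro!: epoly_coeffs_0)
    have "good (Q - monom c d)"
      unfolding good_def
    proof (intro conjI)
      show "Q - monom c d \<in> cpolys"
        using QC(1) by (auto simp: cpolys_def c_def)
      show "epoly (Q - monom c d) = 0" "epoly (dpoly (Q - monom c d)) \<noteq> 0"
        using QC m by (simp_all add: epoly_def dpoly_diff eval_along_diff)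
    qed
    moreover have "degree (Q - monom c d) < d"
      using d by (intro degree_lessI_coeff) (auto simp: c_def d_def coeff_eq_0)
    ultimately show False using Q(2) unfolding d_def by (metis not_less)
  qed
  let ?u = "linearized (poly Q wm) y"
  have "map_poly (partial_deriv (Var_w m)) Q = 0"
  proof (rule poly_eqI)
    fix k
    have "vars (coeff Q k) \<subseteq> {Var_q, Var_x} \<union> Var_w ` {Suc m..n}"
      using QC(1) by (simp add: cpolys_def from_var_def)
    then have "Var_w m \<notin> vars (coeff Q k)" by auto
    then show "coeff (map_poly (partial_deriv (Var_w m)) Q) k = coeff 0 k"
      by (simp add: coeff_map_poly partial_deriv_not_in_vars)
  qed
  then have "?u m \<noteq> 0" using QC(3) by (simp add: linearized_poly epoly_def)
  moreover have "modulo_gradient ?u (linearized (poly P wm) y)" if "P \<in> cpolys" "epoly P = 0" for P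
    using that
  proof (induction "degree P" arbitrary: P rule: less_induct)
    case less
    show ?case
    proof (cases "degree P < d")
      case True
      \<comment> \<open>Below degree \<open>d\<close> no good polynomial exists, so vanishing along
        \<open>y\<close> passes to derivatives, as \<open>coeffs_vanish\<close> requires.\<close>
      have "eval_along (coeff P k) y = 0" for k
      proof (rule coeffs_vanish[of "degree P"])
        fix P' assume "P' \<in> cpolys" "degree P' \<le> degree P" "epoly P' = 0"
        then show "epoly (dpoly P') = 0" using Q(2)[of P'] True by (auto simp: good_def d_def)
      qed (use less.prems in auto)
      from conormal_linearized_poly[OF less.prems(1) this] show ?thesis
        unfolding modulo_gradient_def by (intro exI[of _ 1] exI[of _ 0]) auto
    next
      case False
      define e where "e = degree P"
      define b where "b = coeff P e"
      \<comment> \<open>One step of pseudo-division: the leading terms cancel, and multiplying by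
        \<open>c\<close> is reversible because \<open>c\<close> is nonzero along
        \<open>y\<close>.\<close>
      define P1 where "P1 = smult c P - monom b (e - d) * Q"
      have cb: "c \<in> from_var n (Suc m)" "b \<in> from_var n (Suc m)"
        using QC(1) less.prems(1) by (auto simp: cpolys_def c_def b_def)
      have "coeff P1 k \<in> from_var n (Suc m)" for k
        using QC(1) less.prems(1) cb
        by (auto simp: P1_def coeff_monom_mult cpolys_def intro!: from_var_diff from_var_mult)
      then have P1: "P1 \<in> cpolys" by (simp add: cpolys_def)
      have e1: "epoly P1 = 0"
        using QC(2) less.prems(2) by (simp add: P1_def epoly_def eval_along_diff eval_along_mult)
      have "degree P1 < e"
      proof (rule degree_lessI_coeff)
        show "e > 0" using False d by (simp add: e_def)
        fix k assume "e \<le> k"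
        then consider "k = e" | "k > e" by linarith
        then show "coeff P1 k = 0"
        proof cases
          case 1
          then have "coeff P1 k = c * b - b * c" using False
            by (simp add: P1_def coeff_monom_mult b_def c_def e_def)
          then show ?thesis by (simp add: mult.commute)
        next
          case 2
          then have "coeff P k = 0" "coeff Q (k - (e - d)) = 0"
            using False by (auto intro!: coeff_eq_0 simp: e_def d_def)
          then show ?thesis by (simp add: P1_def coeff_monom_mult)
        qed
      qed
      from less.hyps[OF this[unfolded e_def] P1 e1] obtain \<mu> \<nu> v
        where v: "\<mu> \<noteq> 0" "conormal n y (Suc m) v" "\<And>i. \<mu> * linearized (poly P1 wm) y i = \<nu> * ?u i + v i"
        by (auto simp: modulo_gradient_def)
      \<comment> \<open>In the product rule the terms in which the multipliers are differentiated
        drop out, since \<open>P\<close> and \<open>Q\<close> vanish along \<open>y\<close>.\<close>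
      have g: "linearized (poly P1 wm) y i = eval_along c y * linearized (poly P wm) y i
          - eval_along (poly (monom b (e - d)) wm) y * ?u i" for i
        using QC(2) less.prems(2) by (simp add: P1_def linearized_diff linearized_mult epoly_def)
      have "(\<mu> * eval_along c y) * linearized (poly P wm) y i
          = (\<nu> + \<mu> * eval_along (poly (monom b (e - d)) wm) y) * ?u i + v i" for i
        using v(3)[of i] unfolding g by (simp add: algebra_simps)
      then show ?thesis
        unfolding modulo_gradient_def using v(1,2) c
        by (intro exI[of _ "\<mu> * eval_along c y"]
            exI[of _ "\<nu> + \<mu> * eval_along (poly (monom b (e - d)) wm) y"] exI[of _ v]) simp
    qed
  qed
  ultimately show ?thesis using that[of ?u] by blast
qed

lemma conormal_modulo:
  assumes u: "\<And>P. P \<in> cpolys \<Longrightarrow> epoly P = 0 \<Longrightarrow> modulo_gradient u (linearized (poly P wm) y)"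
    and "conormal n y m a"
  shows "modulo_gradient u a"
  using assms(2)
proof (induction rule: conormal.induct)
  case (gradient F g)
  obtain P where "\<And>k. coeff P k \<in> from_var n (Suc m)" and F: "F = poly P wm"
    using from_var_as_poly[OF gradient(1)] by blast
  then have "modulo_gradient u (linearized F y)"
    using u[of P] gradient(2) by (simp add: cpolys_def epoly_def)
  then obtain \<mu> \<nu> b where "\<mu> \<noteq> 0" "conormal n y (Suc m) b" and e: "\<And>i. \<mu> * linearized F y i = \<nu> * u i + b i"
    by (auto simp: modulo_gradient_def)
  moreover have "\<mu> * (g * linearized F y i) = (g * \<nu>) * u i + g * b i" for i
    using arg_cong[OF e[of i], of "(*) g"] by (simp add: algebra_simps)
  ultimately show ?case
    unfolding modulo_gradient_def using conormal_scale[of n y "Suc m" b g] by blast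
next
  case (add a1 a2)
  obtain \<mu>1 \<nu>1 b1 where 1: "\<mu>1 \<noteq> 0" "conormal n y (Suc m) b1" "\<And>i. \<mu>1 * a1 i = \<nu>1 * u i + b1 i"
    using add.IH(1) by (auto simp: modulo_gradient_def)
  obtain \<mu>2 \<nu>2 b2 where 2: "\<mu>2 \<noteq> 0" "conormal n y (Suc m) b2" "\<And>i. \<mu>2 * a2 i = \<nu>2 * u i + b2 i"
    using add.IH(2) by (auto simp: modulo_gradient_def)
  have "(\<mu>1 * \<mu>2) * (a1 i + a2 i) = (\<mu>2 * \<nu>1 + \<mu>1 * \<nu>2) * u i + (\<mu>2 * b1 i + \<mu>1 * b2 i)" for i
  proof -
    have "(\<mu>1 * \<mu>2) * (a1 i + a2 i) = \<mu>2 * (\<mu>1 * a1 i) + \<mu>1 * (\<mu>2 * a2 i)" by (simp add: algebra_simps)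
    then show ?thesis unfolding 1(3) 2(3) by (simp add: algebra_simps)
  qed
  moreover have "conormal n y (Suc m) (\<lambda>i. \<mu>2 * b1 i + \<mu>1 * b2 i)"
    using 1(2) 2(2) by (intro conormal.add conormal_scale)
  ultimately show ?case
    unfolding modulo_gradient_def using 1(1) 2(1)
    by (intro exI[of _ "\<mu>1 * \<mu>2"] exI[of _ "\<mu>2 * \<nu>1 + \<mu>1 * \<nu>2"]
        exI[of _ "\<lambda>i. \<mu>2 * b1 i + \<mu>1 * b2 i"]) simp
next
  case (div c a)
  then obtain \<mu> \<nu> b where "\<mu> \<noteq> 0" "conormal n y (Suc m) b" "\<And>i. \<mu> * (c * a i) = \<nu> * u i + b i"
    by (auto simp: modulo_gradient_def)
  then show ?case
    unfolding modulo_gradient_def using div(1)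
    by (intro exI[of _ "\<mu> * c"] exI[of _ \<nu>] exI[of _ b]) (simp add: mult.assoc)
qed

text \<open>Compare the entries at \<open>m\<close>: that of \<open>a\<close> is zero by assumption,
  that of \<open>b\<close> because \<open>b\<close> has level \<open>Suc m\<close>. In a domain this
  leaves \<open>\<nu> = 0\<close> or \<open>u m = 0\<close>, and the latter makes \<open>u\<close>
  zero; so the multiple of \<open>u\<close> disappears.\<close>

lemma conormal_step:
  assumes "conormal n y m a" "a m = 0"
  shows "conormal n y (Suc m) a"
proof -
  obtain u where u: "u m = 0 \<Longrightarrow> u = (\<lambda>_. 0)"
    "\<And>P. P \<in> cpolys \<Longrightarrow> epoly P = 0 \<Longrightarrow> modulo_gradient u (linearized (poly P wm) y)"
    using gradients_modulo by blast
  obtain \<mu> \<nu> b where b: "\<mu> \<noteq> 0" "conormal n y (Suc m) b" "\<And>i. \<mu> * a i = \<nu> * u i + b i"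
    using conormal_modulo[OF u(2) assms(1)] by (auto simp: modulo_gradient_def)
  have "\<nu> * u m = 0" using b(3)[of m] assms(2) conormal_below[OF b(2), of m] by simp
  then have "\<nu> * u i = 0" for i by (cases "u m = 0") (simp_all add: u(1))
  then have "(\<lambda>i. \<mu> * a i) = b" using b(3) by (simp add: fun_eq_iff)
  then show ?thesis using b(1,2) conormal.div[of \<mu> n y "Suc m" a] by simp
qed

end

lemma conormal_eliminate:
  assumes "conormal n y 0 a" "\<And>i. i < m \<Longrightarrow> a i = 0"
  shows "conormal n y m a"
  using assms(2)
proof (induction m)
  case 0
  show ?case by (rule assms(1))
next
  case (Suc m)
  then have "conormal n y m a" "a m = 0" by simp_all
  then show ?case by (rule conormal_step)
qed

text \<open>Multipliers from \<open>conormal\<close> are power series, whereas \<open>polyop\<close>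
  admits only polynomials in x. Truncated multipliers give the prescribed coefficients up to any
  order, and for slope parameter 0 only finitely many of them matter.\<close>

definition op_approx :: "nat set \<Rightarrow> ratfun fps \<Rightarrow> (nat \<Rightarrow> ratfun fps) \<Rightarrow> bool" where
  "op_approx J y a \<longleftrightarrow> (\<forall>N. \<exists>\<Phi> d\<Phi>. polyop J \<Phi> d\<Phi> \<and> \<Phi> y = 0 \<and> (\<forall>i. lowzero N (d\<Phi> i y - a i)))"

lemma op_approx_eval_along:
  assumes "vars F \<subseteq> {Var_q, Var_x} \<union> Var_w ` J" "eval_along F y = 0"
  shows "op_approx J y (\<lambda>i. g * linearized F y i)"
  unfolding op_approx_def
proof (intro allI exI conjI)
  fix N i
  show "polyop J (\<lambda>y. fps_cutoff N g * eval_along F y) (\<lambda>i y. fps_cutoff N g * linearized F y i)"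
    unfolding linearized_def using assms(1) by (intro polyop_scale polyop_eval_along) auto
  show "fps_cutoff N g * eval_along F y = 0" using assms(2) by simp
  show "lowzero N (fps_cutoff N g * linearized F y i - g * linearized F y i)"
    using lowzero_mult_right[OF lowzero_cutoff[of N g], of "linearized F y i"] by (simp add: algebra_simps)
qed

lemma op_approx_combination:
  assumes "op_approx J y a" "op_approx J y b"
  shows "op_approx J y (\<lambda>i. g * a i + h * b i)"
  unfolding op_approx_def
proof
  fix N
  obtain \<Phi> d\<Phi> where \<Phi>: "polyop J \<Phi> d\<Phi>" "\<Phi> y = 0" "\<And>i. lowzero N (d\<Phi> i y - a i)"
    using assms(1) unfolding op_approx_def by blast
  obtain \<Psi> d\<Psi> where \<Psi>: "polyop J \<Psi> d\<Psi>" "\<Psi> y = 0" "\<And>i. lowzero N (d\<Psi> i y - b i)"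
    using assms(2) unfolding op_approx_def by blast
  show "\<exists>\<Phi> d\<Phi>. polyop J \<Phi> d\<Phi> \<and> \<Phi> y = 0 \<and> (\<forall>i. lowzero N (d\<Phi> i y - (g * a i + h * b i)))"
  proof (intro exI conjI allI)
    show "polyop J (\<lambda>y. fps_cutoff N g * \<Phi> y + fps_cutoff N h * \<Psi> y) (\<lambda>i y. fps_cutoff N g * d\<Phi> i y + fps_cutoff N h * d\<Psi> i y)"
      by (intro polyop.add polyop_scale fin_supp_cutoff \<Phi>(1) \<Psi>(1))
    show "fps_cutoff N g * \<Phi> y + fps_cutoff N h * \<Psi> y = 0" using \<Phi>(2) \<Psi>(2) by simp
    show "lowzero N (fps_cutoff N g * d\<Phi> i y + fps_cutoff N h * d\<Psi> i y - (g * a i + h * b i))" for i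
      by (intro lowzero_diff_add lowzero_diff_mult lowzero_cutoff \<Phi> \<Psi>)
  qed
qed

text \<open>The rule \<open>div\<close> cannot be undone within power series, so the vector is
  reached only up to a nonzero factor; sums are brought to a common factor.\<close>

lemma conormal_approx:
  assumes "conormal n y m a"
  shows "\<exists>c. c \<noteq> 0 \<and> op_approx {m..n} y (\<lambda>i. c * a i)"
  using assms
proof (induction rule: conormal.induct)
  case (gradient F g)
  then have "op_approx {m..n} y (\<lambda>i. g * linearized F y i)"
    by (intro op_approx_eval_along) (auto simp: from_var_def)
  then show ?case by (intro exI[of _ 1]) simp
next
  case (add a b)
  obtain c where c: "c \<noteq> 0" "op_approx {m..n} y (\<lambda>i. c * a i)" using add.IH(1) by blast
  obtain d where d: "d \<noteq> 0" "op_approx {m..n} y (\<lambda>i. d * b i)" using add.IH(2) by blast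
  have "op_approx {m..n} y (\<lambda>i. d * (c * a i) + c * (d * b i))"
    by (rule op_approx_combination[OF c(2) d(2)])
  moreover have "d * (c * a i) + c * (d * b i) = (c * d) * (a i + b i)" for i
    by (simp add: algebra_simps)
  ultimately show ?case using c(1) d(1) by (intro exI[of _ "c * d"]) simp
next
  case (div c a)
  then obtain d where d: "d \<noteq> 0" "op_approx {m..n} y (\<lambda>i. d * (c * a i))" by blast
  then show ?case using div(1) by (intro exI[of _ "d * c"]) (simp add: mult.assoc)
qed

subsection \<open>Slopes of the Newton polygon\<close>

lemma newton_polygon_subset:
  assumes above: "\<And>i. i \<le> n \<Longrightarrow> a i \<noteq> 0 \<Longrightarrow> c + k * real i \<le> real (subdegree (a i))"
    and p: "p \<in> newton_polygon n a"
  shows "0 \<le> fst p \<and> fst p \<le> real n \<and> c \<le> inner (- k, 1) p"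
proof -
  have "newton_polygon n a \<subseteq> ({0..real n} \<times> UNIV) \<inter> {p. inner (- k, 1) p \<ge> c}"
    unfolding newton_polygon_def
  proof (rule hull_minimal)
    show "(\<Union>i\<in>{i. i \<le> n \<and> a i \<noteq> 0}. {(real i, h) |h. real (subdegree (a i)) \<le> h})
        \<subseteq> ({0..real n} \<times> UNIV) \<inter> {p. inner (- k, 1) p \<ge> c}"
      using above by (force simp: inner_Pair)
    show "convex (({0..real n} \<times> UNIV) \<inter> {p. inner (- k, 1 :: real) p \<ge> c})"
      by (intro convex_Int convex_Times convex_halfspace_ge) auto
  qed
  then show ?thesis using p by auto
qed

text \<open>The line of slope \<open>k\<close> supports the polygon, so their intersection is a
  face. It lies on a line and contains two distinct points, hence is an edge; it lies over the strip
  between 0 and \<open>n\<close>, hence is bounded.\<close>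

lemma slopes_newton_polygonI:
  assumes above: "\<And>i. i \<le> n \<Longrightarrow> a i \<noteq> 0 \<Longrightarrow> c + k * real i \<le> real (subdegree (a i))"
    and i: "i \<le> n" "a i \<noteq> 0" "real (subdegree (a i)) = c + k * real i"
    and j: "j \<le> n" "a j \<noteq> 0" "real (subdegree (a j)) = c + k * real j"
    and ij: "i < j"
  shows "ereal k \<in> slopes (newton_polygon n a)"
proof -
  let ?N = "newton_polygon n a"
  let ?H = "{p. inner (- k, 1 :: real) p = c}"
  define e where "e = ?N \<inter> ?H"
  have pt: "(real l, real (subdegree (a l))) \<in> ?N" if "l \<le> n" "a l \<noteq> 0" for l
    unfolding newton_polygon_def by (rule hull_inc) (use that in auto)
  have "convex ?N" by (simp add: newton_polygon_def)
  then have "e face_of ?N"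
    unfolding e_def using newton_polygon_subset[OF above]
    by (intro face_of_Int_supporting_hyperplane_ge) auto
  moreover have ie: "(real i, real (subdegree (a i))) \<in> e" and je: "(real j, real (subdegree (a j))) \<in> e"
    unfolding e_def using i j pt[OF i(1,2)] pt[OF j(1,2)] by (auto simp: inner_Pair)
  have "aff_dim e = 1"
  proof (rule antisym)
    have "aff_dim e \<le> aff_dim ?H" by (rule aff_dim_subset) (simp add: e_def)
    also have "\<dots> = 1" by (subst aff_dim_hyperplane) (auto simp: zero_prod_def)
    finally show "aff_dim e \<le> 1" .
    have "aff_dim {(real i, real (subdegree (a i))), (real j, real (subdegree (a j)))} \<le> aff_dim e"
      using ie je by (intro aff_dim_subset) auto
    then show "1 \<le> aff_dim e" using ij by (simp add: aff_dim_2)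
  qed
  ultimately have "e edge_of ?N" by (simp add: edge_of_def)
  moreover have "bounded e"
  proof (rule bounded_subset)
    show "bounded ({0..real n} \<times> {- (\<bar>c\<bar> + \<bar>k\<bar> * real n)..\<bar>c\<bar> + \<bar>k\<bar> * real n})"
      by (intro bounded_Times bounded_closed_interval)
    show "e \<subseteq> {0..real n} \<times> {- (\<bar>c\<bar> + \<bar>k\<bar> * real n)..\<bar>c\<bar> + \<bar>k\<bar> * real n}"
    proof
      fix p assume p: "p \<in> e"
      then have f: "0 \<le> fst p" "fst p \<le> real n"
        using newton_polygon_subset[OF above] by (auto simp: e_def)
      have "snd p = c + k * fst p" using p by (cases p) (auto simp: e_def inner_Pair)
      moreover have "\<bar>k * fst p\<bar> \<le> \<bar>k\<bar> * real n" using f by (simp add: abs_mult mult_left_mono)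
      ultimately show "p \<in> {0..real n} \<times> {- (\<bar>c\<bar> + \<bar>k\<bar> * real n)..\<bar>c\<bar> + \<bar>k\<bar> * real n}"
        using f by (auto simp: mem_Times_iff)
    qed
  qed
  moreover have "(snd (real j, real (subdegree (a j))) - snd (real i, real (subdegree (a i))))
      / (fst (real j, real (subdegree (a j))) - fst (real i, real (subdegree (a i)))) = k"
    using i(3) j(3) ij by (simp add: field_simps)
  moreover have "fst (real i, real (subdegree (a i))) < fst (real j, real (subdegree (a j)))"
    using ij by simp
  ultimately show ?thesis
    unfolding slopes_def using ie je by blast
qed

text \<open>With \<open>\<tau> = 1\<close> this is about the part of the polygon right of its bottom, with \<open>\<tau> = -1\<close> left of it.\<close>

lemma newton_polygon_side:
  fixes \<tau> :: real
  assumes j: "j \<le> n" "a j \<noteq> 0"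
    and bot: "\<And>i. i \<le> n \<Longrightarrow> a i \<noteq> 0 \<Longrightarrow> subdegree (a j) \<le> subdegree (a i)"
    and strict: "\<And>i. i \<le> n \<Longrightarrow> a i \<noteq> 0 \<Longrightarrow> \<tau> * real j < \<tau> * real i \<Longrightarrow> subdegree (a j) < subdegree (a i)"
    and ex: "i0 \<le> n" "a i0 \<noteq> 0" "\<tau> * real j < \<tau> * real i0"
  obtains k where "k > 0" "ereal (\<tau> * k) \<in> slopes (newton_polygon n a)"
    "\<And>i. i \<le> n \<Longrightarrow> a i \<noteq> 0 \<Longrightarrow>
       k * (\<tau> * real i - \<tau> * real j) \<le> real (subdegree (a i)) - real (subdegree (a j))"
proof -
  define I where "I = {i. i \<le> n \<and> a i \<noteq> 0 \<and> \<tau> * real j < \<tau> * real i}"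
  \<comment> \<open>\<open>\<tau> * q i\<close> is the slope of the segment from the vertex over
    \<open>j\<close> to the vertex over \<open>i\<close>. The least \<open>q i\<close> gives a line
    that no vertex lies below.\<close>
  define q where "q i = (real (subdegree (a i)) - real (subdegree (a j))) / (\<tau> * real i - \<tau> * real j)" for i
  have I: "finite I" "I \<noteq> {}" using ex by (auto simp: I_def)
  define k where "k = Min (q ` I)"
  have "k \<in> q ` I" unfolding k_def using I by (intro Min_in) auto
  then obtain m where m: "m \<in> I" "k = q m" by auto
  have k: "k > 0" using m strict[of m] by (auto simp: I_def q_def)
  have ineq: "k * (\<tau> * real i - \<tau> * real j) \<le> real (subdegree (a i)) - real (subdegree (a j))"
    if i: "i \<le> n" "a i \<noteq> 0" for i
  proof (cases "i \<in> I")
    case True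
    then have "k \<le> q i" unfolding k_def using I by auto
    then show ?thesis using True by (simp add: q_def I_def pos_le_divide_eq)
  next
    case False
    then have "k * (\<tau> * real i - \<tau> * real j) \<le> 0"
      using i k by (intro mult_nonneg_nonpos) (auto simp: I_def)
    then show ?thesis using bot[OF i] by simp
  qed
  define c where "c = real (subdegree (a j)) - \<tau> * k * real j"
  have above: "c + \<tau> * k * real i \<le> real (subdegree (a i))" if "i \<le> n" "a i \<noteq> 0" for i
    using ineq[OF that] by (simp add: c_def algebra_simps)
  have jc: "real (subdegree (a j)) = c + \<tau> * k * real j" by (simp add: c_def)
  have mc: "real (subdegree (a m)) = c + \<tau> * k * real m"
  proof -
    have "k * (\<tau> * real m - \<tau> * real j) = real (subdegree (a m)) - real (subdegree (a j))"
      using m by (auto simp: q_def I_def)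
    then show ?thesis by (simp add: c_def algebra_simps)
  qed
  have mI: "m \<le> n" "a m \<noteq> 0" "m \<noteq> j" using m by (auto simp: I_def)
  have "ereal (\<tau> * k) \<in> slopes (newton_polygon n a)"
  proof (cases "m < j")
    case True
    show ?thesis by (rule slopes_newton_polygonI[OF above mI(1,2) mc j jc True])
  next
    case False
    then have "j < m" using mI by simp
    show ?thesis by (rule slopes_newton_polygonI[OF above j jc mI(1,2) mc \<open>j < m\<close>])
  qed
  then show ?thesis using that k ineq by blast
qed

text \<open>Turns the polygon into the hypotheses of the growth estimate: \<open>l\<close> is the
  height of the bottom and \<open>j\<close> its end in direction \<open>\<tau>\<close>. If
  \<open>R\<close> is infinite then no vertex lies beyond \<open>j\<close>, since it would create a
  side of finite slope; this is the case \<open>\<sigma> = 0\<close>.\<close>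

lemma newton_polygon_slope_bound:
  fixes \<tau> :: real and R :: ereal
  assumes ex: "i0 \<le> n" "a i0 \<noteq> 0"
    and R: "R > 0" "\<And>k. k > 0 \<Longrightarrow> ereal (\<tau> * k) \<in> slopes (newton_polygon n a) \<Longrightarrow> R \<le> ereal k"
  obtains j l \<sigma> where "j \<le> n" "1 / R = ereal \<sigma>" "\<sigma> \<ge> 0"
    "\<And>i. i \<le> n \<Longrightarrow> lowzero l (a i)" "fps_nth (a j) l \<noteq> 0"
    "\<And>i t. i \<le> n \<Longrightarrow> fps_nth (a i) (l + t) \<noteq> 0 \<Longrightarrow> \<tau> * real i - \<tau> * real j \<le> \<sigma> * real t"
    "\<And>i. i \<le> n \<Longrightarrow> a i \<noteq> 0 \<Longrightarrow> \<sigma> = 0 \<Longrightarrow> \<tau> * real i \<le> \<tau> * real j"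
proof -
  define I where "I = {i. i \<le> n \<and> a i \<noteq> 0}"
  have I: "finite I" "I \<noteq> {}" using ex by (auto simp: I_def)
  define l where "l = Min ((\<lambda>i. subdegree (a i)) ` I)"
  define T where "T = {i \<in> I. subdegree (a i) = l}"
  have "l \<in> (\<lambda>i. subdegree (a i)) ` I" unfolding l_def using I by (intro Min_in) auto
  then have T: "finite T" "T \<noteq> {}" using I by (auto simp: T_def)
  have "Max ((\<lambda>i. \<tau> * real i) ` T) \<in> (\<lambda>i. \<tau> * real i) ` T" using T by (intro Max_in) auto
  then obtain j where j: "j \<in> T" "Max ((\<lambda>i. \<tau> * real i) ` T) = \<tau> * real j" by auto
  have jmax: "\<tau> * real i \<le> \<tau> * real j" if "i \<in> T" for i
    using Max_ge[of "(\<lambda>i. \<tau> * real i) ` T" "\<tau> * real i"] that T j(2) by auto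
  have jI: "j \<le> n" "a j \<noteq> 0" "subdegree (a j) = l" using j by (auto simp: T_def I_def)
  have bot: "l \<le> subdegree (a i)" if "i \<le> n" "a i \<noteq> 0" for i
    unfolding l_def using that I by (intro Min_le) (auto simp: I_def)
  have strict: "l < subdegree (a i)" if "i \<le> n" "a i \<noteq> 0" "\<tau> * real j < \<tau> * real i" for i
    using bot[OF that(1,2)] jmax[of i] that by (force simp: T_def I_def)
  have Rcases: "R = \<infinity> \<or> (\<exists>\<rho>>0. R = ereal \<rho>)" using R(1) by (cases R) auto
  then obtain \<sigma> where \<sigma>: "1 / R = ereal \<sigma>" "\<sigma> \<ge> 0"
    by (auto simp: one_ereal_def)
  have ineq: "\<tau> * real i - \<tau> * real j \<le> \<sigma> * (real (subdegree (a i)) - real l)"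
    if i: "i \<le> n" "a i \<noteq> 0" for i
  proof (cases "\<tau> * real j < \<tau> * real i")
    case True
    obtain k where k: "k > 0" "ereal (\<tau> * k) \<in> slopes (newton_polygon n a)"
      "k * (\<tau> * real i - \<tau> * real j) \<le> real (subdegree (a i)) - real (subdegree (a j))"
      using newton_polygon_side[OF jI(1,2) _ _ i True] bot strict jI(3) i by metis
    have "R \<le> ereal k" using R(2) k by blast
    then obtain \<rho> where \<rho>: "\<rho> > 0" "R = ereal \<rho>" "\<rho> \<le> k" using Rcases by auto
    have "\<sigma> = 1 / \<rho>" using \<sigma>(1) \<rho> by (simp add: one_ereal_def)
    moreover have "\<rho> * (\<tau> * real i - \<tau> * real j) \<le> real (subdegree (a i)) - real l"
    proof (rule order_trans)
      show "\<rho> * (\<tau> * real i - \<tau> * real j) \<le> k * (\<tau> * real i - \<tau> * real j)"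
        using True \<rho>(3) by (intro mult_right_mono) auto
    qed (use k(3) jI(3) in simp)
    ultimately show ?thesis
      using \<rho>(1) by (simp only: times_divide_eq_left mult_1_left pos_le_divide_eq mult.commute)
  next
    case False
    then show ?thesis using bot[OF i] \<sigma>(2) by (smt (verit) mult_nonneg_nonneg of_nat_le_iff)
  qed
  show ?thesis
  proof (rule that[of j \<sigma> l])
    show "j \<le> n" "1 / R = ereal \<sigma>" "\<sigma> \<ge> 0" by fact+
    show "lowzero l (a i)" if "i \<le> n" for i
      using bot[OF that] by (cases "a i = 0") (auto simp: lowzero_def intro: nth_less_subdegree_zero)
    show "fps_nth (a j) l \<noteq> 0" using jI by auto
    show "\<tau> * real i - \<tau> * real j \<le> \<sigma> * real t" if i: "i \<le> n" "fps_nth (a i) (l + t) \<noteq> 0" for i t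
    proof -
      have "a i \<noteq> 0" using i(2) by auto
      have "subdegree (a i) \<le> l + t" using i(2) by (rule subdegree_leI)
      then have "\<sigma> * (real (subdegree (a i)) - real l) \<le> \<sigma> * real t"
        using \<sigma>(2) by (intro mult_left_mono) auto
      then show ?thesis using ineq[OF i(1) \<open>a i \<noteq> 0\<close>] by linarith
    qed
    show "\<tau> * real i \<le> \<tau> * real j" if "i \<le> n" "a i \<noteq> 0" "\<sigma> = 0" for i
      using ineq[OF that(1,2)] that(3) by simp
  qed
qed

subsection \<open>Degree and order as valuations\<close>

lemma ratfun_cases:
  fixes a :: ratfun
  assumes "a \<noteq> 0"
  obtains f g where "a = Fract f g" "f \<noteq> 0" "g \<noteq> 0"
proof (cases a)
  case (Fract f g)
  then show ?thesis using assms that by (auto simp: Zero_fract_def eq_fract)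
qed

lemma Fract_add_nonzero:
  fixes f g f' g' :: "complex poly"
  assumes "g \<noteq> 0" "g' \<noteq> 0" "Fract f g + Fract f' g' \<noteq> 0"
  shows "f * g' + f' * g \<noteq> 0"
  using assms by (auto simp: Zero_fract_def eq_fract)

lemma order_add_ge:
  fixes f g :: "complex poly"
  assumes "f + g \<noteq> 0" "f \<noteq> 0" "g \<noteq> 0"
  shows "min (order c f) (order c g) \<le> order c (f + g)"
proof -
  have "[:- c, 1:] ^ min (order c f) (order c g) dvd f + g"
    using assms by (intro dvd_add) (simp_all add: order_divides)
  then show ?thesis using assms(1) by (simp add: order_divides)
qed

text \<open>The conversion to a real number sends the infinite value at 0 to 0; this is harmless
  because \<open>vle\<close> accepts 0 for every bound.\<close>

definition deg_val :: "ratfun \<Rightarrow> real" where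
  "deg_val a = real_of_ereal (deg_q a)"

definition neg_ord_val :: "ratfun \<Rightarrow> real" where
  "neg_ord_val a = - real_of_ereal (ord_q a)"

lemma deg_val_Fract: "f \<noteq> 0 \<Longrightarrow> g \<noteq> 0 \<Longrightarrow> deg_val (Fract f g) = real (degree f) - real (degree g)"
  by (simp add: deg_val_def deg_q_Fract)

lemma neg_ord_val_Fract:
  "f \<noteq> 0 \<Longrightarrow> g \<noteq> 0 \<Longrightarrow> neg_ord_val (Fract f g) = real (order 0 g) - real (order 0 f)"
  by (simp add: neg_ord_val_def ord_q_Fract)

lemma deg_q_eq_deg_val: "a \<noteq> 0 \<Longrightarrow> deg_q a = ereal (deg_val a)"
  by (erule ratfun_cases) (simp add: deg_val_Fract deg_q_Fract)

lemma ord_q_eq_neg_ord_val: "a \<noteq> 0 \<Longrightarrow> ord_q a = ereal (- neg_ord_val a)"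
  by (erule ratfun_cases) (simp add: neg_ord_val_Fract ord_q_Fract)

interpretation deg: q_valuation deg_val 1
proof
  fix a b :: ratfun assume "a \<noteq> 0" "b \<noteq> 0"
  obtain f g where a: "a = Fract f g" "f \<noteq> 0" "g \<noteq> 0" using ratfun_cases[OF \<open>a \<noteq> 0\<close>] .
  obtain f' g' where b: "b = Fract f' g'" "f' \<noteq> 0" "g' \<noteq> 0" using ratfun_cases[OF \<open>b \<noteq> 0\<close>] .
  show "deg_val (a * b) = deg_val a + deg_val b"
    using a b by (simp add: deg_val_Fract degree_mult_eq)
  assume "a + b \<noteq> 0"
  then have nz: "f * g' + f' * g \<noteq> 0" using a b Fract_add_nonzero by blast
  have "degree (f * g' + f' * g) \<le> max (degree f + degree g') (degree f' + degree g)"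
    using degree_add_le_max[of "f * g'" "f' * g"] a b by (simp add: degree_mult_eq)
  then show "deg_val (a + b) \<le> max (deg_val a) (deg_val b)"
    using a b nz by (simp add: deg_val_Fract degree_mult_eq)
next
  show "deg_val qvar = 1" by (simp add: qvar_def deg_val_Fract)
qed

interpretation ord: q_valuation neg_ord_val "- 1"
proof
  fix a b :: ratfun assume "a \<noteq> 0" "b \<noteq> 0"
  obtain f g where a: "a = Fract f g" "f \<noteq> 0" "g \<noteq> 0" using ratfun_cases[OF \<open>a \<noteq> 0\<close>] .
  obtain f' g' where b: "b = Fract f' g'" "f' \<noteq> 0" "g' \<noteq> 0" using ratfun_cases[OF \<open>b \<noteq> 0\<close>] .
  show "neg_ord_val (a * b) = neg_ord_val a + neg_ord_val b"
    using a b by (simp add: neg_ord_val_Fract order_mult)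
  assume "a + b \<noteq> 0"
  then have nz: "f * g' + f' * g \<noteq> 0" using a b Fract_add_nonzero by blast
  have "min (order 0 f + order 0 g') (order 0 f' + order 0 g) \<le> order 0 (f * g' + f' * g)"
    using order_add_ge[OF nz, of 0] a b by (simp add: order_mult)
  then show "neg_ord_val (a + b) \<le> max (neg_ord_val a) (neg_ord_val b)"
    using a b nz by (simp add: neg_ord_val_Fract order_mult)
next
  have "order 0 [:0, 1 :: complex:] = 1"
    using order_power_n_n[of "0 :: complex" 1] by simp
  then show "neg_ord_val qvar = - 1" by (simp add: qvar_def neg_ord_val_Fract)
qed

section \<open>From eventual bounds to the normalized upper limits\<close>

lemma normalized_identity:
  fixes \<sigma> x C :: real
  shows "\<sigma> * x\<^sup>2 / 2 + C * x - \<sigma> * (x * (x - 1) / 2) = (C + \<sigma> / 2) * x"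
  by (simp add: power2_eq_square algebra_simps diff_divide_distrib)

lemma limsup_normalized_le:
  fixes v :: "nat \<Rightarrow> ereal"
  assumes "eventually (\<lambda>h. v h \<le> ereal (\<sigma> * (real h)\<^sup>2 / 2 + C * real h)) sequentially"
  shows "limsup (\<lambda>h. 1 / ereal (real h) * (v h - ereal \<sigma> * ereal (real h * (real h - 1) / 2))) < \<infinity>"
proof -
  have "eventually (\<lambda>h. 1 / ereal (real h) * (v h - ereal \<sigma> * ereal (real h * (real h - 1) / 2))
      \<le> ereal (C + \<sigma> / 2)) sequentially"
    using assms eventually_gt_at_top[of 0]
  proof eventually_elim
    case (elim h)
    have "v h - ereal \<sigma> * ereal (real h * (real h - 1) / 2)
        \<le> ereal (\<sigma> * (real h)\<^sup>2 / 2 + C * real h) - ereal \<sigma> * ereal (real h * (real h - 1) / 2)"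
      by (rule ereal_minus_mono[OF elim(1) order_refl])
    also have "\<dots> = ereal ((C + \<sigma> / 2) * real h)"
      using normalized_identity[of \<sigma> "real h" C] by simp
    finally have "1 / ereal (real h) * (v h - ereal \<sigma> * ereal (real h * (real h - 1) / 2))
        \<le> 1 / ereal (real h) * ereal ((C + \<sigma> / 2) * real h)"
      by (rule ereal_mult_left_mono) (use elim(2) in \<open>auto simp: one_ereal_def\<close>)
    also have "\<dots> = ereal (C + \<sigma> / 2)" using elim(2) by (simp add: one_ereal_def)
    finally show ?case .
  qed
  from Limsup_bounded[OF this] show ?thesis by (rule le_less_trans) simp
qed

lemma limsup_normalized_ge:
  fixes v :: "nat \<Rightarrow> ereal"
  assumes "eventually (\<lambda>h. ereal (- (\<sigma> * (real h)\<^sup>2 / 2 + C * real h)) \<le> v h) sequentially"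
  shows "limsup (\<lambda>h. 1 / ereal (real h) * (v h - ereal (- \<sigma>) * ereal (real h * (real h - 1) / 2))) > - \<infinity>"
proof -
  have "eventually (\<lambda>h. ereal (- C - \<sigma> / 2)
      \<le> 1 / ereal (real h) * (v h - ereal (- \<sigma>) * ereal (real h * (real h - 1) / 2))) sequentially"
    using assms eventually_gt_at_top[of 0]
  proof eventually_elim
    case (elim h)
    have "ereal (- C - \<sigma> / 2) = 1 / ereal (real h) * ereal ((- C - \<sigma> / 2) * real h)"
      using elim(2) by (simp add: one_ereal_def)
    also have "ereal ((- C - \<sigma> / 2) * real h)
        = ereal (- (\<sigma> * (real h)\<^sup>2 / 2 + C * real h)) - ereal (- \<sigma>) * ereal (real h * (real h - 1) / 2)"
      using normalized_identity[of "- \<sigma>" "real h" "- C"] by simp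
    also have "1 / ereal (real h) * \<dots>
        \<le> 1 / ereal (real h) * (v h - ereal (- \<sigma>) * ereal (real h * (real h - 1) / 2))"
      by (rule ereal_mult_left_mono[OF ereal_minus_mono[OF elim(1) order_refl]])
        (use elim(2) in \<open>auto simp: one_ereal_def\<close>)
    finally show ?case .
  qed
  from le_Limsup[OF sequentially_bot this]
  show ?thesis by (rule less_le_trans[rotated]) simp
qed

lemma degree_growth:
  assumes F: "vars F \<subseteq> {Var_q, Var_x} \<union> Var_w ` {..n}" "eval_along F y = 0" "linearized F y n \<noteq> 0"
    and r: "smallest_positive_slope (newton_polygon n (linearized F y)) r"
  obtains \<sigma> C where "1 / r = ereal \<sigma>"
    "eventually (\<lambda>h. deg.vle (fps_nth y h) (\<sigma> * (real h)\<^sup>2 / 2 + C * real h)) sequentially"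
proof -
  have rmin: "r \<le> ereal k"
    if "k > 0" "ereal (1 * k) \<in> slopes (newton_polygon n (linearized F y))" for k
    using r that by (auto simp: smallest_positive_slope_def)
  have "r > 0" using r by (simp add: smallest_positive_slope_def)
  note side = newton_polygon_slope_bound[of n n "linearized F y" r 1, OF order_refl F(3) this rmin]
  obtain j l \<sigma> where np: "j \<le> n" "1 / r = ereal \<sigma>" "\<sigma> \<ge> 0"
    "\<And>i. i \<le> n \<Longrightarrow> lowzero l (linearized F y i)" "fps_nth (linearized F y j) l \<noteq> 0"
    "\<And>i t. i \<le> n \<Longrightarrow> fps_nth (linearized F y i) (l + t) \<noteq> 0 \<Longrightarrow> 1 * real i - 1 * real j \<le> \<sigma> * real t"
    "\<And>i. i \<le> n \<Longrightarrow> linearized F y i \<noteq> 0 \<Longrightarrow> \<sigma> = 0 \<Longrightarrow> 1 * real i \<le> 1 * real j"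
    by (rule side, assumption, assumption, rule that)
  have "\<exists>C. eventually (\<lambda>h. deg.vle (fps_nth y h) (\<sigma> * (real h)\<^sup>2 / 2 + C * real h)) sequentially"
  proof (rule deg.coefficient_growth)
    show "polyop {..n} (eval_along F) (\<lambda>i y. linearized F y i)"
      unfolding linearized_def using F(1) by (rule polyop_eval_along)
    assume "\<sigma> = 0"
    \<comment> \<open>The coefficient at \<open>n\<close> is nonzero, so with no side to the right
      of the bottom the bottom ends at \<open>n\<close>. All dilates are then covered, including
      those with zero coefficient.\<close>
    then have "n \<le> j" using np(7)[OF order_refl F(3)] by simp
    then show "\<forall>i\<in>{..n}. 1 * real i \<le> 1 * real j" by auto
  next
    fix i t assume "i \<in> {..n}" "fps_nth (linearized F y i) (l + t) \<noteq> 0"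
    then show "1 * real i - 1 * real j \<le> \<sigma> * real t" by (intro np(6)) auto
  qed (simp_all add: F(2) np(1,3,4,5))
  with np(2) show ?thesis using that by blast
qed

text \<open>If the polygon has no negative slope, the coefficients of the operator with index below the
  bottom vertex \<open>j\<close> vanish along \<open>y\<close>, but the variables \<open>w\<^sub>i\<close> with \<open>i < j\<close> may still occur in \<open>F\<close>;
  they are eliminated first, because their nonlinear terms would spoil the estimate.\<close>

lemma order_growth:
  assumes F: "vars F \<subseteq> {Var_q, Var_x} \<union> Var_w ` {..n}" "eval_along F y = 0" "linearized F y n \<noteq> 0"
    and r: "largest_negative_slope (newton_polygon n (linearized F y)) r"
  obtains \<sigma> C where "1 / r = ereal (- \<sigma>)"
    "eventually (\<lambda>h. ord.vle (fps_nth y h) (\<sigma> * (real h)\<^sup>2 / 2 + C * real h)) sequentially"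
proof -
  have rmax: "- r \<le> ereal k"
    if "k > 0" "ereal (- 1 * k) \<in> slopes (newton_polygon n (linearized F y))" for k
  proof -
    have "ereal (- 1 * k) \<le> r" using r that by (auto simp: largest_negative_slope_def)
    then show ?thesis by (cases r) auto
  qed
  have "r < 0" using r by (simp add: largest_negative_slope_def)
  then have "- r > 0" by (cases r) auto
  note side = newton_polygon_slope_bound[of n n "linearized F y" "- r" "- 1", OF order_refl F(3) this rmax]
  obtain j l \<sigma> where np: "j \<le> n" "1 / - r = ereal \<sigma>" "\<sigma> \<ge> 0"
    "\<And>i. i \<le> n \<Longrightarrow> lowzero l (linearized F y i)" "fps_nth (linearized F y j) l \<noteq> 0"
    "\<And>i t. i \<le> n \<Longrightarrow> fps_nth (linearized F y i) (l + t) \<noteq> 0 \<Longrightarrow> - 1 * real i - - 1 * real j \<le> \<sigma> * real t"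
    "\<And>i. i \<le> n \<Longrightarrow> linearized F y i \<noteq> 0 \<Longrightarrow> \<sigma> = 0 \<Longrightarrow> - 1 * real i \<le> - 1 * real j"
    by (rule side, assumption, assumption, rule that)
  have "\<exists>C. eventually (\<lambda>h. ord.vle (fps_nth y h) (\<sigma> * (real h)\<^sup>2 / 2 + C * real h)) sequentially"
  proof (cases "\<sigma> = 0")
    case False
    show ?thesis
    proof (rule ord.coefficient_growth)
      show "polyop {..n} (eval_along F) (\<lambda>i y. linearized F y i)"
        unfolding linearized_def using F(1) by (rule polyop_eval_along)
    next
      fix i t assume "i \<in> {..n}" "fps_nth (linearized F y i) (l + t) \<noteq> 0"
      then show "- 1 * real i - - 1 * real j \<le> \<sigma> * real t" by (intro np(6)) auto
    qed (simp_all add: F(2) False np(1,3,4,5))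
  next
    case True
    have "F \<in> from_var n 0" using F(1) by (simp add: from_var_def atMost_atLeast0)
    from conormal.gradient[OF this F(2), of 1] have "conormal n y 0 (linearized F y)" by simp
    moreover have "linearized F y i = 0" if "i < j" for i
      using np(7)[of i] np(1) that True by (cases "linearized F y i = 0") simp_all
    ultimately have "conormal n y j (linearized F y)" by (rule conormal_eliminate)
    from conormal_approx[OF this] obtain c
      where c: "c \<noteq> 0" "op_approx {j..n} y (\<lambda>i. c * linearized F y i)" by blast
    define d where "d = subdegree c"
    \<comment> \<open>The bottom of the scaled operator has height \<open>d + l\<close>; agreement
      through that index, hence precision \<open>Suc (d + l)\<close>, preserves it and its
      coefficient at \<open>j\<close>.\<close>
    obtain \<Phi> d\<Phi> where \<Phi>: "polyop {j..n} \<Phi> d\<Phi>" "\<Phi> y = 0"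
      "\<And>i. lowzero (Suc (d + l)) (d\<Phi> i y - c * linearized F y i)"
      using c(2) unfolding op_approx_def by blast
    have cl: "lowzero d c" by (auto simp: lowzero_def d_def)
    \<comment> \<open>All remaining indices are at least \<open>j\<close>, so with
      \<open>\<epsilon> = - 1\<close> no dilate is stronger than the one at \<open>j\<close>: the
      slope condition and \<open>s0\<close> hold trivially.\<close>
    show ?thesis
    proof (rule ord.coefficient_growth[OF \<Phi>(1) _ \<Phi>(2), where j = j and l = "d + l"])
      show "lowzero (d + l) (d\<Phi> i y)" if "i \<in> {j..n}" for i
      proof -
        have "lowzero (d + l) (c * linearized F y i)" using that by (intro lowzero_mult cl np(4)) simp
        then show ?thesis using \<Phi>(3)[of i] by (simp add: lowzero_def)
      qed
      have "fps_nth (c * linearized F y j) (d + l) = fps_nth c d * fps_nth (linearized F y j) l"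
        using fps_mult_nth_low[OF np(4)[OF np(1)] cl] by (simp add: mult.commute)
      moreover have "fps_nth c d \<noteq> 0" using c(1) by (simp add: d_def)
      ultimately show "fps_nth (d\<Phi> j y) (d + l) \<noteq> 0"
        using \<Phi>(3)[of j] np(5) by (simp add: lowzero_def)
    qed (simp_all add: np(1) True)
  qed
  then obtain C where
    C: "eventually (\<lambda>h. ord.vle (fps_nth y h) (\<sigma> * (real h)\<^sup>2 / 2 + C * real h)) sequentially" ..
  have "1 / r = ereal (- \<sigma>)"
    using np(2) \<open>r < 0\<close> by (cases r) (auto simp: one_ereal_def)
  then show ?thesis using C by (rule that)
qed

theorem theorem6:
  fixes n :: nat and F :: mpoly and y :: "ratfun fps" and r r' s s' :: ereal
  assumes "vars F \<subseteq> {Var_q, Var_x} \<union> Var_w ` {..n}"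
    and "eval_along F y = 0"
    and "eval_along (partial_deriv (Var_w n) F) y \<noteq> 0"
    and "smallest_positive_slope (newton_polygon n (linearized F y)) r"
    and "largest_negative_slope (newton_polygon n (linearized F y)) r'"
    and "s = 1 / r"
    and "s' = 1 / r'"
  shows "limsup (\<lambda>h. 1 / ereal (real h) *
             (deg_q (fps_nth y h) - s * ereal (real h * (real h - 1) / 2))) < \<infinity> \<and>
         limsup (\<lambda>h. 1 / ereal (real h) *
             (ord_q (fps_nth y h) - s' * ereal (real h * (real h - 1) / 2))) > -\<infinity>"
proof
  have n: "linearized F y n \<noteq> 0" using assms(3) by (simp add: linearized_def)
  obtain \<sigma> C where d: "1 / r = ereal \<sigma>"
    "eventually (\<lambda>h. deg.vle (fps_nth y h) (\<sigma> * (real h)\<^sup>2 / 2 + C * real h)) sequentially"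
    using degree_growth[OF assms(1,2) n] assms(4) by blast
  have "deg_q a \<le> ereal b" if "deg.vle a b" for a b
    using that by (cases "a = 0") (auto simp: deg.vle_def deg_q_eq_deg_val, simp add: deg_q_def)
  with d(2) have "eventually (\<lambda>h. deg_q (fps_nth y h) \<le> ereal (\<sigma> * (real h)\<^sup>2 / 2 + C * real h)) sequentially"
    by (elim eventually_mono)
  from limsup_normalized_le[OF this] show "limsup (\<lambda>h. 1 / ereal (real h) *
      (deg_q (fps_nth y h) - s * ereal (real h * (real h - 1) / 2))) < \<infinity>"
    using assms(6) d(1) by simp
  obtain \<sigma>' C' where o: "1 / r' = ereal (- \<sigma>')"
    "eventually (\<lambda>h. ord.vle (fps_nth y h) (\<sigma>' * (real h)\<^sup>2 / 2 + C' * real h)) sequentially"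
    using order_growth[OF assms(1,2) n] assms(5) by blast
  have "ereal (- b) \<le> ord_q a" if "ord.vle a b" for a b
    using that by (cases "a = 0") (auto simp: ord.vle_def ord_q_eq_neg_ord_val, simp add: ord_q_def)
  with o(2) have "eventually (\<lambda>h. ereal (- (\<sigma>' * (real h)\<^sup>2 / 2 + C' * real h)) \<le> ord_q (fps_nth y h)) sequentially"
    by (elim eventually_mono)
  from limsup_normalized_ge[OF this] show "limsup (\<lambda>h. 1 / ereal (real h) *
      (ord_q (fps_nth y h) - s' * ereal (real h * (real h - 1) / 2))) > - \<infinity>"
    using assms(7) o(1) by simp
qed

end
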